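(* In the control setting described in the context, with the standing assumptions (i)–(iv) on $V_\varepsilon$, $H$ and the optimal control and the assumption that $V_0$ is almost everywhere differentiable, let $F_0$ be the locally uniform limit of $F_\varepsilon$ as $\varepsilon\to0$. Assume that $F_0$ forms a double well potential with local minima $x_\pm$ and local maximum $x_*$, where $x_-<x_*<x_+$, and that $F_0$ is $C^1$ close to $x_\pm$ and $x_*$. Assume furthermore that there exist $a,q,M>0$ and $b\in\mathbb R$, independent of $\varepsilon$, such that $F_\varepsilon(x)\ge ax^q+b$ for all $x>M$. Let $\tau^\varepsilon_{x_-}=\inf\{t\ge0:\ x^\varepsilon(t)\le x_-\}$ be the first hitting time of $x_-$ by the solution $x^\varepsilon$ of the optimally controlled equation $$dx^\varepsilon(t)=-F_\varepsilon'(x^\varepsilon(t))dt+\sqrt{2\varepsilon}\,dW_t .$$ Then the expectation of $\tau^\varepsilon_{x_-}$ when $x^\varepsilon$ starts at $x_+$ satisfies $$\lim_{\varepsilon\to0}\varepsilon\log\mathbb E_{x_+}\big[\tau^\varepsilon_{x_-}\big]=F_0(x_* )-F_0(x_+).$$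
   Context: Setting. Let $(\Omega,\mathcal F,\{\mathcal F_t\}_{t\ge0},\mathbb P)$ be a filtered probability space satisfying the usual conditions with a Brownian motion $W$, let $U=(0,\infty)$ be the control space and $\rho>0$. For $\varepsilon>0$ consider $$dx^\varepsilon(t)=f(x^\varepsilon(t),u(t))dt+\sqrt{2\varepsilon}\,dW_t,\qquad x^\varepsilon(0)=x\in\mathbb R,$$ where $f\in C^1(\mathbb R\times U)$, $|f_x|\le C$, $|f(x,u)|\le C(1+|x|+|u|)$. Let $G$ be continuous on $\mathbb R\times U$ with $G(x,\cdot)\in C^1(U)$, and $$V_\varepsilon(x)=\sup_{u\in\mathfrak U}\mathbb E_x\Big[\int_0^\infty e^{-\rho s}G(x^\varepsilon(s),u(s))ds\Big],$$ where $\mathfrak U$ is the set of $\mathcal F_t$-adapted, $\mathbb P$-a.s. locally integrable $U$-valued processes $u$ for which the expectation above is $<\infty$ and the state equation has a unique strong solution. Assumptions. (i) $V_\varepsilon$ is a classical solution of $-\varepsilon V_\varepsilon''-H(x,V_\varepsilon')+\rho V_\varepsilon=0$, where $H(x,p)=\sup_{u\in U}\{f(x,u)p+G(x,u)\}$. (ii) There is $\varepsilon_0>0$ such that $V_\varepsilon$ and $V_\varepsilon'$ are bounded uniformly in $\varepsilon<\varepsilon_0$ on every compact subset of $\mathbb R$. (iii) $H$ is $C^2$ and $H_{pp}>0$. (iv) There is an optimal stationary Markov control policy $u^*(s)=g(x^*(s),V_\varepsilon'(x^*(s)))=:\bar u^*(x^*(s))$, with $g$ continuous, such that $f_u(x,\bar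 u^*(x))V_\varepsilon'(x)+G_u(x,\bar u^*(x))=0$. Limit. As $\varepsilon\to0$, $V_\varepsilon\to V_0$ locally uniformly, where $V_0$ is a viscosity solution of $-H(x,V_0')+\rho V_0=0$; it is assumed that $V_0$ is almost everywhere differentiable. Potential. $F_\varepsilon$ is defined by $F_\varepsilon'(x)=-f(x,g(x,V_\varepsilon'(x)))$, normalized by $F_\varepsilon(0)=0$. Under these assumptions $F_\varepsilon$ converges locally uniformly as $\varepsilon\to 0$ to a function $F_0$ which is almost everywhere differentiable with $F_0'(x)=-f(x,g(x,V_0'(x)))$. "Double well potential with local minima $x_\pm$ and local maximum $x_*$" means that $x_-,x_+$ are the only local minimum points and $x_*$ is the only local maximum point of $F_0$. *)

theory Defs
  imports "HOL-Probability.Probability"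
begin

subsection \<open>Regularity and extrema\<close>

text \<open>Continuous differentiability is only used on open sets \<open>S\<close>, hence the full filter \<open>at z\<close>.\<close>

definition C1_on :: "'a::real_normed_vector set \<Rightarrow> ('a \<Rightarrow> 'b::real_normed_vector) \<Rightarrow> bool" where
  "C1_on S f \<longleftrightarrow>
    (\<exists>f'. (\<forall>z\<in>S. (f has_derivative blinfun_apply (f' z)) (at z)) \<and> continuous_on S f')"

definition C2_on :: "'a::real_normed_vector set \<Rightarrow> ('a \<Rightarrow> 'b::real_normed_vector) \<Rightarrow> bool" where
  "C2_on S f \<longleftrightarrow>
    (\<exists>f'. (\<forall>z\<in>S. (f has_derivative blinfun_apply (f' z)) (at z)) \<and> C1_on S f')"

definition local_min :: "(real \<Rightarrow> real) \<Rightarrow> real \<Rightarrow> bool" where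
  "local_min h x \<longleftrightarrow> (\<forall>\<^sub>F y in nhds x. h x \<le> h y)"

definition local_max :: "(real \<Rightarrow> real) \<Rightarrow> real \<Rightarrow> bool" where
  "local_max h x \<longleftrightarrow> (\<forall>\<^sub>F y in nhds x. h y \<le> h x)"

definition double_well :: "(real \<Rightarrow> real) \<Rightarrow> real \<Rightarrow> real \<Rightarrow> real \<Rightarrow> bool" where
  "double_well h xm xs xp \<longleftrightarrow>
    xm < xs \<and> xs < xp \<and> {x. local_min h x} = {xm, xp} \<and> {x. local_max h x} = {xs}"

text \<open>Viscosity solutions (Crandall--Lions) of the first-order equation
  \<open>E(x, v(x), v'(x)) = 0\<close> on the real line.\<close>

definition viscosity_solution :: "(real \<Rightarrow> real \<Rightarrow> real \<Rightarrow> real) \<Rightarrow> (real \<Rightarrow> real) \<Rightarrow> bool" where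
  "viscosity_solution E v \<longleftrightarrow> continuous_on UNIV v \<and>
    (\<forall>\<phi> x. C1_on UNIV \<phi> \<longrightarrow>
      (local_max (\<lambda>y. v y - \<phi> y) x \<longrightarrow> E x (v x) (deriv \<phi> x) \<le> 0) \<and>
      (local_min (\<lambda>y. v y - \<phi> y) x \<longrightarrow> E x (v x) (deriv \<phi> x) \<ge> 0))"


subsection \<open>Filtered probability space and Brownian motion\<close>

text \<open>Time is the half-line \<open>t \<ge> 0\<close>. The library's \<open>filtration\<close> is indexed by a whole type;
  a filtration on \<open>t \<ge> 0\<close> is extended to negative times by its value at \<open>0\<close>.\<close>

locale usual_filtered_prob_space = prob_space M + complete_measure M + filtration "space M" Fil
  for M :: "'w measure" and Fil :: "real \<Rightarrow> 'w measure" +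
  assumes sets_Fil: "sets (Fil t) \<subseteq> sets M"
    and null_sets_Fil: "null_sets M \<subseteq> sets (Fil 0)"
    and right_continuous_Fil: "0 \<le> t \<Longrightarrow> sets (Fil t) = (\<Inter>s\<in>{t<..}. sets (Fil s))"

locale brownian_motion = usual_filtered_prob_space M Fil
  for M :: "'w measure" and Fil :: "real \<Rightarrow> 'w measure" +
  fixes W :: "real \<Rightarrow> 'w \<Rightarrow> real"
  assumes W_adapted: "0 \<le> t \<Longrightarrow> W t \<in> borel_measurable (Fil t)"
    and W_start: "AE \<omega> in M. W 0 \<omega> = 0"
    and W_continuous: "AE \<omega> in M. continuous_on {0..} (\<lambda>t. W t \<omega>)"
    and W_normal: "0 \<le> s \<Longrightarrow> s < t \<Longrightarrow>
      distributed M lborel (\<lambda>\<omega>. W t \<omega> - W s \<omega>) (normal_density 0 (sqrt (t - s)))"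
    and W_indep: "0 \<le> s \<Longrightarrow> s < t \<Longrightarrow>
      indep_set (sets (Fil s)) {(\<lambda>\<omega>. W t \<omega> - W s \<omega>) -` A \<inter> space M | A. A \<in> sets borel}"


subsection \<open>State equation\<close>

text \<open>Strong solutions of \<open>dX = \<beta>(t, \<omega>, X) dt + \<sigma> dW\<close>, \<open>X(0) = x\<close>. As \<open>\<sigma>\<close> is constant, the
  stochastic integral is just \<open>\<sigma> W\<close>.\<close>

definition sde_solution :: "'w measure \<Rightarrow> (real \<Rightarrow> 'w measure) \<Rightarrow> (real \<Rightarrow> 'w \<Rightarrow> real) \<Rightarrow>
    (real \<Rightarrow> 'w \<Rightarrow> real \<Rightarrow> real) \<Rightarrow> real \<Rightarrow> real \<Rightarrow> (real \<Rightarrow> 'w \<Rightarrow> real) \<Rightarrow> bool" where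
  "sde_solution M Fil W \<beta> \<sigma> x X \<longleftrightarrow>
    (\<forall>t\<ge>0. X t \<in> borel_measurable (Fil t)) \<and>
    (AE \<omega> in M. continuous_on {0..} (\<lambda>t. X t \<omega>)) \<and>
    (AE \<omega> in M. \<forall>t\<ge>0. set_integrable lborel {0..t} (\<lambda>s. \<beta> s \<omega> (X s \<omega>)) \<and>
      X t \<omega> = x + (LINT s:{0..t}|lborel. \<beta> s \<omega> (X s \<omega>)) + \<sigma> * W t \<omega>)"

definition unique_sde_solution :: "'w measure \<Rightarrow> (real \<Rightarrow> 'w measure) \<Rightarrow> (real \<Rightarrow> 'w \<Rightarrow> real) \<Rightarrow>
    (real \<Rightarrow> 'w \<Rightarrow> real \<Rightarrow> real) \<Rightarrow> real \<Rightarrow> real \<Rightarrow> (real \<Rightarrow> 'w \<Rightarrow> real) \<Rightarrow> bool" where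
  "unique_sde_solution M Fil W \<beta> \<sigma> x X \<longleftrightarrow>
    sde_solution M Fil W \<beta> \<sigma> x X \<and>
    (\<forall>Y. sde_solution M Fil W \<beta> \<sigma> x Y \<longrightarrow> (AE \<omega> in M. \<forall>t\<ge>0. Y t \<omega> = X t \<omega>))"


subsection \<open>Control problem with control space \<open>U = (0,\<infinity>)\<close>\<close>

text \<open>Integral with values in the extended reals. Since \<open>\<infinity> - \<infinity> = \<infinity>\<close> in \<^typ>\<open>ereal\<close>, for a measurable
  integrand a value \<open>< \<infinity>\<close> says that the integral exists and is \<open>< \<infinity>\<close>.\<close>

definition ext_integral :: "'a measure \<Rightarrow> ('a \<Rightarrow> ereal) \<Rightarrow> ereal" where
  "ext_integral N h =
    enn2ereal (\<integral>\<^sup>+ z. e2ennreal (h z) \<partial>N) - enn2ereal (\<integral>\<^sup>+ z. e2ennreal (- h z) \<partial>N)"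

definition discounted_payoff :: "real \<Rightarrow> (real \<Rightarrow> real \<Rightarrow> real) \<Rightarrow>
    (real \<Rightarrow> 'w \<Rightarrow> real) \<Rightarrow> (real \<Rightarrow> 'w \<Rightarrow> real) \<Rightarrow> 'w \<Rightarrow> ereal" where
  "discounted_payoff \<rho> G X u \<omega> =
    ext_integral (restrict_space lborel {0..}) (\<lambda>s. ereal (exp (- \<rho> * s) * G (X s \<omega>) (u s \<omega>)))"

text \<open>The control \<open>u\<close> is admissible for the initial state \<open>x\<close> and noise parameter \<open>\<epsilon>\<close>, and \<open>X\<close> is
  the (up to indistinguishability unique) corresponding state process.\<close>

definition admissible :: "'w measure \<Rightarrow> (real \<Rightarrow> 'w measure) \<Rightarrow> (real \<Rightarrow> 'w \<Rightarrow> real) \<Rightarrow>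
    (real \<Rightarrow> real \<Rightarrow> real) \<Rightarrow> (real \<Rightarrow> real \<Rightarrow> real) \<Rightarrow> real \<Rightarrow> real \<Rightarrow> real \<Rightarrow>
    (real \<Rightarrow> 'w \<Rightarrow> real) \<Rightarrow> (real \<Rightarrow> 'w \<Rightarrow> real) \<Rightarrow> bool" where
  "admissible M Fil W f G \<rho> \<epsilon> x u X \<longleftrightarrow>
    (\<forall>t\<ge>0. u t \<in> borel_measurable (Fil t)) \<and>
    (\<forall>t\<ge>0. \<forall>\<omega>\<in>space M. 0 < u t \<omega>) \<and>
    (AE \<omega> in M. \<forall>t\<ge>0. set_integrable lborel {0..t} (\<lambda>s. u s \<omega>)) \<and>
    unique_sde_solution M Fil W (\<lambda>s \<omega> y. f y (u s \<omega>)) (sqrt (2 * \<epsilon>)) x X \<and>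
    discounted_payoff \<rho> G X u \<in> borel_measurable M \<and>
    ext_integral M (discounted_payoff \<rho> G X u) < \<infinity>"

definition value_function :: "'w measure \<Rightarrow> (real \<Rightarrow> 'w measure) \<Rightarrow> (real \<Rightarrow> 'w \<Rightarrow> real) \<Rightarrow>
    (real \<Rightarrow> real \<Rightarrow> real) \<Rightarrow> (real \<Rightarrow> real \<Rightarrow> real) \<Rightarrow> real \<Rightarrow> real \<Rightarrow> real \<Rightarrow> ereal" where
  "value_function M Fil W f G \<rho> \<epsilon> x =
    (SUP (u, X)\<in>{(u, X). admissible M Fil W f G \<rho> \<epsilon> x u X}.
      ext_integral M (discounted_payoff \<rho> G X u))"

definition hamiltonian :: "(real \<Rightarrow> real \<Rightarrow> real) \<Rightarrow> (real \<Rightarrow> real \<Rightarrow> real) \<Rightarrow> real \<Rightarrow> real \<Rightarrow> ereal" where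
  "hamiltonian f G x p = (SUP u\<in>{0<..}. ereal (f x u * p + G x u))"

text \<open>The stationary Markov policy \<open>\<phi>\<close> is optimal from every initial state: the closed-loop control
  \<open>\<phi>(X)\<close> is admissible with state process \<open>X\<close> and attains the value function.\<close>

definition optimal_markov_policy :: "'w measure \<Rightarrow> (real \<Rightarrow> 'w measure) \<Rightarrow> (real \<Rightarrow> 'w \<Rightarrow> real) \<Rightarrow>
    (real \<Rightarrow> real \<Rightarrow> real) \<Rightarrow> (real \<Rightarrow> real \<Rightarrow> real) \<Rightarrow> real \<Rightarrow> real \<Rightarrow> (real \<Rightarrow> real) \<Rightarrow> bool" where
  "optimal_markov_policy M Fil W f G \<rho> \<epsilon> \<phi> \<longleftrightarrow>
    (\<forall>x. \<exists>X. admissible M Fil W f G \<rho> \<epsilon> x (\<lambda>s \<omega>. \<phi> (X s \<omega>)) X \<and>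
      ext_integral M (discounted_payoff \<rho> G X (\<lambda>s \<omega>. \<phi> (X s \<omega>)))
        = value_function M Fil W f G \<rho> \<epsilon> x)"


subsection \<open>Hitting time\<close>

text \<open>First time at which \<open>X\<close> is at or below \<open>y\<close>; the infimum of the empty set is \<open>\<infinity>\<close>.\<close>

definition hitting_time :: "(real \<Rightarrow> 'w \<Rightarrow> real) \<Rightarrow> real \<Rightarrow> 'w \<Rightarrow> ennreal" where
  "hitting_time X y \<omega> = (INF t\<in>{t. 0 \<le> t \<and> X t \<omega> \<le> y}. ennreal t)"

definition ext_ln :: "ennreal \<Rightarrow> ereal" where
  "ext_ln z = (if z = 0 then -\<infinity> else if z = \<infinity> then \<infinity> else ereal (ln (enn2real z)))"

end

theory Submission
  imports Defs "HOL-Real_Asymp.Real_Asymp"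
begin

text \<open>Write \<open>\<beta> = - F\<^sub>\<epsilon>'\<close> for the drift of the optimally controlled equation. The mean hitting time of
  \<open>x\<^sub>-\<close> from \<open>x\<^sub>+\<close> is, for each fixed \<open>\<epsilon>\<close>, the double integral
  \<open>1/\<epsilon> \<integral> exp (F\<^sub>\<epsilon> y / \<epsilon>) \<integral> exp (- F\<^sub>\<epsilon> z / \<epsilon>) dz dy\<close> over \<open>x\<^sub>- < y < x\<^sub>+\<close> and \<open>z > y\<close>: it solves
  \<open>\<epsilon> u'' - F\<^sub>\<epsilon>' u' = - 1\<close> with \<open>u(x\<^sub>-) = 0\<close>. By Laplace's principle its exponential rate is the
  supremum of \<open>F\<^sub>0 y - F\<^sub>0 z\<close> over \<open>x\<^sub>- \<le> y \<le> x\<^sub>+\<close> and \<open>z \<ge> y\<close>, and the shape of a double well makes this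
  supremum \<open>F\<^sub>0 x\<^sub>* - F\<^sub>0 x\<^sub>+\<close>.

  Only upper and lower bounds that agree to exponential order are needed, and they come from
  test functions: a bounded nondecreasing \<open>v\<close> with \<open>\<epsilon> v'' - F\<^sub>\<epsilon>' v' = - 1\<close> on the relevant interval
  bounds the mean hitting time from above (\<open>hitting_time_upper_bound\<close>), and one with
  \<open>\<epsilon> v'' - F\<^sub>\<epsilon>' v' \<ge> - 1\<close> bounds it from below (\<open>hitting_time_lower_bound\<close>). Both kinds are obtained in
  \<open>test_function_exists\<close> from the double integral by cutting off the inner integral on the right
  and the outer one on the left.

  The noise is additive, so Dynkin's formula for such test functions does not require a
  stochastic integral. On the grid \<open>t\<^sub>j = j T / n\<close> a step of the solution is the displacement by
  the drift plus an independent Gaussian increment. A second-order expansion gives the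
  conditional expectation of \<open>v(X(t\<^sub>j\<^sub>+\<^sub>1)) - v(X(t\<^sub>j))\<close> up to \<open>o(1/n)\<close> (\<open>one_step_estimate\<close>). The sum
  over the steps before the solution leaves an interval telescopes, and \<open>n \<rightarrow> \<infinity>\<close> yields the
  formula (\<open>grid_dynkin\<close>). Stopping is done on the grid as well; Fatou's lemma and its reverse
  transfer the bounds to the hitting time, so that its measurability is never an issue.

  The Laplace asymptotics follow from pointwise bounds on \<open>F\<^sub>\<epsilon> y - F\<^sub>\<epsilon> z\<close>. On a compact interval
  these come from locally uniform convergence, and for large \<open>z\<close> from the growth condition, which
  dominates the integrand by \<open>1 / (1 + z\<^sup>2)\<close> times a factor of the right exponential order.\<close>

section \<open>Test functions and their second-order expansion\<close>

text \<open>The global bounds make every expectation below finite. The uniform continuity of the second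
  derivative gives a remainder \<open>o(D\<^sup>2)\<close> that is uniform in the base point; a Lipschitz bound would be
  too much to ask, since the second derivative of a solution of \<open>\<epsilon> v'' - F' v' = - \<phi>\<close> is only as
  regular as \<open>F'\<close>.\<close>

definition smooth_test :: "(real \<Rightarrow> real) \<Rightarrow> (real \<Rightarrow> real) \<Rightarrow> (real \<Rightarrow> real) \<Rightarrow> bool" where
  "smooth_test v p q \<longleftrightarrow>
    (\<forall>y. (v has_real_derivative p y) (at y)) \<and> (\<forall>y. (p has_real_derivative q y) (at y)) \<and>
    bounded (range v) \<and> bounded (range p) \<and> bounded (range q) \<and>
    uniformly_continuous_on UNIV q \<and> (\<forall>y. 0 \<le> p y)"

lemma smooth_test_bound:
  assumes "smooth_test v p q"
  obtains K where "\<And>x. \<bar>v x\<bar> \<le> K" "\<And>x. \<bar>p x\<bar> \<le> K" "\<And>x. \<bar>q x\<bar> \<le> K"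
proof -
  obtain a b c where "\<And>x. \<bar>v x\<bar> \<le> a" "\<And>x. \<bar>p x\<bar> \<le> b" "\<And>x. \<bar>q x\<bar> \<le> c"
    using assms unfolding smooth_test_def bounded_iff real_norm_def by (metis rangeI)
  then show thesis
    by (intro that[of "max a (max b c)"]) (auto simp: le_max_iff_disj)
qed

lemma smooth_test_continuous:
  assumes "smooth_test v p q"
  shows "continuous_on UNIV v" "continuous_on UNIV p" "continuous_on UNIV q"
  using assms unfolding smooth_test_def
  by (meson DERIV_isCont continuous_at_imp_continuous_on uniformly_continuous_imp_continuous)+

text \<open>A quadratic term absorbs the pairs \<open>x\<close>, \<open>y\<close> that are not close. With this form of the modulus the
  Taylor remainder is a polynomial in the increment, so that only even moments of a Gaussian
  variable enter later.\<close>

lemma second_derivative_modulus: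
  fixes q :: "real \<Rightarrow> real"
  assumes "uniformly_continuous_on UNIV q" "bounded (range q)" "\<eta> > 0"
  obtains K where "K \<ge> 0" "\<And>x y. \<bar>q x - q y\<bar> \<le> \<eta> + K * (x - y)\<^sup>2"
proof -
  obtain Q where Q: "\<And>x. \<bar>q x\<bar> \<le> Q"
    using assms(2) by (auto simp: bounded_iff)
  obtain d where d: "d > 0" "\<And>x y. dist x y < d \<Longrightarrow> dist (q x) (q y) < \<eta>"
    using assms(1,3) unfolding uniformly_continuous_on_def by (metis UNIV_I)
  have Q0: "Q \<ge> 0" using Q[of 0] by linarith
  have "\<bar>q x - q y\<bar> \<le> \<eta> + 2 * Q / d\<^sup>2 * (x - y)\<^sup>2" for x y
  proof (cases "dist x y < d")
    case True
    then have "\<bar>q x - q y\<bar> \<le> \<eta>" using d(2)[of x y] by (simp add: dist_real_def)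
    moreover have "0 \<le> 2 * Q / d\<^sup>2 * (x - y)\<^sup>2" using Q0 by simp
    ultimately show ?thesis by linarith
  next
    case False
    then have "d\<^sup>2 \<le> (x - y)\<^sup>2"
      using d(1) by (simp add: dist_real_def power2_le_iff_abs_le[symmetric] abs_le_square_iff[symmetric])
    then have "1 \<le> (x - y)\<^sup>2 / d\<^sup>2" using d(1) by (simp add: field_simps)
    then have "2 * Q * 1 \<le> 2 * Q * ((x - y)\<^sup>2 / d\<^sup>2)" using Q0 by (intro mult_left_mono) auto
    moreover have "\<bar>q x - q y\<bar> \<le> 2 * Q" using Q[of x] Q[of y] by linarith
    ultimately show ?thesis using assms(3) by simp
  qed
  then show thesis using that[of "2 * Q / d\<^sup>2"] Q0 by simp
qed

lemma taylor_remainder: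
  fixes v p q :: "real \<Rightarrow> real"
  assumes v: "\<And>y. (v has_real_derivative p y) (at y)"
    and p: "\<And>y. (p has_real_derivative q y) (at y)"
    and K: "\<And>x y. \<bar>q x - q y\<bar> \<le> \<eta> + K * (x - y)\<^sup>2" "K \<ge> 0"
  shows "\<bar>v (z + D) - v z - p z * D - q z * D\<^sup>2 / 2\<bar> \<le> (\<eta> + K * D\<^sup>2) * D\<^sup>2 / 2"
proof (cases "D = 0")
  case False
  define diff where "diff = (\<lambda>m::nat. if m = 0 then v else if m = 1 then p else q)"
  define a where "a = min z (z + D)"
  define b where "b = max z (z + D)"
  have "\<exists>t. (if z + D < z then z + D < t \<and> t < z else z < t \<and> t < z + D) \<and>
    v (z + D) = (\<Sum>m<2. (diff m z / fact m) * (z + D - z) ^ m) + (diff 2 t / fact 2) * (z + D - z) ^ 2"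
  proof (rule Taylor[of 2 diff v a b z "z + D"])
    show "\<forall>m t. m < 2 \<and> a \<le> t \<and> t \<le> b \<longrightarrow> DERIV (diff m) t :> diff (Suc m) t"
      using v p by (auto simp: diff_def less_Suc_eq numeral_2_eq_2)
  qed (use False in \<open>auto simp: diff_def a_def b_def\<close>)
  then obtain t where t: "if z + D < z then z + D < t \<and> t < z else z < t \<and> t < z + D"
    and e: "v (z + D) = v z + p z * D + q t / 2 * D\<^sup>2"
    by (auto simp: diff_def numeral_2_eq_2)
  have "\<bar>t - z\<bar> \<le> \<bar>D\<bar>" using t by (auto split: if_splits)
  then have "(t - z)\<^sup>2 \<le> D\<^sup>2" by (simp add: abs_le_square_iff)
  then have "\<bar>q t - q z\<bar> \<le> \<eta> + K * D\<^sup>2"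
    using K(1)[of t z] K(2) mult_left_mono by (smt (verit))
  then have "\<bar>(q t - q z) * D\<^sup>2 / 2\<bar> \<le> (\<eta> + K * D\<^sup>2) * D\<^sup>2 / 2"
    by (simp add: abs_mult mult_right_mono)
  then show ?thesis unfolding e by (simp add: field_simps)
qed simp

text \<open>The increment splits into a drift part \<open>B\<close> of order \<open>h\<close> and a noise part \<open>w\<close> of order \<open>sqrt h\<close>.
  Only \<open>w\<^sup>2\<close> has the order \<open>h\<close> of the main terms, and it appears in the error with an arbitrarily
  small factor; the terms \<open>h\<^sup>2\<close> and \<open>w\<^sup>4\<close> are negligible after summation over \<open>1 / h\<close> steps.\<close>

lemma second_order_expansion:
  fixes v p q :: "real \<Rightarrow> real"
  assumes v: "smooth_test v p q" and "\<eta> > 0" "C \<ge> 0"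
  obtains c where "c \<ge> 0"
    "\<And>z h B w. 0 \<le> h \<Longrightarrow> h \<le> 1 \<Longrightarrow> \<bar>B\<bar> \<le> C * h \<Longrightarrow>
      \<bar>v (z + B + w) - v z - p z * B - p z * w - q z * w\<^sup>2 / 2\<bar> \<le> \<eta> * w\<^sup>2 + c * (h\<^sup>2 + w ^ 4)"
proof -
  obtain Q where Q: "\<And>x. \<bar>q x\<bar> \<le> Q"
    using v by (auto simp: smooth_test_def bounded_iff)
  then have Q0: "Q \<ge> 0" by (meson abs_ge_zero order_trans)
  \<comment> \<open>the factor of \<open>w\<^sup>2\<close> comes out as \<open>e (1 + Q / 2)\<close>\<close>
  define e where "e = \<eta> / (1 + Q)"
  have e: "e > 0" using Q0 assms(2) by (simp add: e_def)
  obtain K where K: "K \<ge> 0" "\<And>x y. \<bar>q x - q y\<bar> \<le> e + K * (x - y)\<^sup>2"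
    using second_derivative_modulus[of q e] v e by (auto simp: smooth_test_def)
  define c where "c = C\<^sup>2 * (e + Q / 2 + Q / (2 * e)) + 4 * K * C ^ 4 + 4 * K"
  have c1: "4 * K \<le> c" using K Q0 e by (simp add: c_def)
  have "\<bar>v (z + B + w) - v z - p z * B - p z * w - q z * w\<^sup>2 / 2\<bar> \<le> \<eta> * w\<^sup>2 + c * (h\<^sup>2 + w ^ 4)"
    if h: "0 \<le> h" "h \<le> 1" and B: "\<bar>B\<bar> \<le> C * h" for z h B w
  proof -
    define D where "D = B + w"
    have 1: "\<bar>v (z + D) - v z - p z * D - q z * D\<^sup>2 / 2\<bar> \<le> (e + K * D\<^sup>2) * D\<^sup>2 / 2"
      using v K by (intro taylor_remainder) (auto simp: smooth_test_def)
    have B2: "B\<^sup>2 \<le> C\<^sup>2 * h\<^sup>2"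
      using B h assms(3) by (metis abs_le_square_iff abs_mult abs_of_nonneg power_mult_distrib)
    have "(B\<^sup>2)\<^sup>2 \<le> (C\<^sup>2 * h\<^sup>2)\<^sup>2" using B2 by (intro power_mono) auto
    also have "\<dots> = C ^ 4 * (h\<^sup>2 * h\<^sup>2)" by (simp add: power_mult_distrib flip: power_mult)
    also have "\<dots> \<le> C ^ 4 * (h\<^sup>2 * 1)"
      using h assms(3) by (intro mult_left_mono) (auto simp: power_le_one)
    finally have B4: "(B\<^sup>2)\<^sup>2 \<le> C ^ 4 * h\<^sup>2" by simp
    have D2: "D\<^sup>2 \<le> 2 * B\<^sup>2 + 2 * w\<^sup>2"
      using zero_le_power2[of "B - w"] by (simp add: D_def power2_eq_square algebra_simps)
    have "(D\<^sup>2)\<^sup>2 \<le> (2 * B\<^sup>2 + 2 * w\<^sup>2)\<^sup>2" using D2 by (intro power_mono) auto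
    also have "\<dots> \<le> 8 * (B\<^sup>2)\<^sup>2 + 8 * (w\<^sup>2)\<^sup>2"
      using zero_le_power2[of "B\<^sup>2 - w\<^sup>2"] by (simp add: power2_eq_square algebra_simps)
    finally have D4: "(D\<^sup>2)\<^sup>2 \<le> 8 * (B\<^sup>2)\<^sup>2 + 8 * (w\<^sup>2)\<^sup>2" .
    have 2: "(e + K * D\<^sup>2) * D\<^sup>2 / 2 \<le> e * (B\<^sup>2 + w\<^sup>2) + 4 * K * ((B\<^sup>2)\<^sup>2 + (w\<^sup>2)\<^sup>2)"
    proof -
      have "(e + K * D\<^sup>2) * D\<^sup>2 / 2 = e * D\<^sup>2 / 2 + K * (D\<^sup>2)\<^sup>2 / 2"
        by (simp add: power2_eq_square algebra_simps add_divide_distrib)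
      also have "\<dots> \<le> e * (2 * B\<^sup>2 + 2 * w\<^sup>2) / 2 + K * (8 * (B\<^sup>2)\<^sup>2 + 8 * (w\<^sup>2)\<^sup>2) / 2"
        using D2 D4 e K(1) by (intro add_mono divide_right_mono mult_left_mono) auto
      finally show ?thesis by (simp add: algebra_simps add_divide_distrib)
    qed
    \<comment> \<open>Young's inequality turns the mixed term into squares of \<open>B\<close> and \<open>w\<close>.\<close>
    have young: "\<bar>2 * B * w\<bar> \<le> B\<^sup>2 / e + e * w\<^sup>2"
    proof -
      have s: "0 \<le> (\<bar>B\<bar> - e * \<bar>w\<bar>)\<^sup>2 / e" using e by simp
      have "(\<bar>B\<bar> - e * \<bar>w\<bar>)\<^sup>2 / e = B\<^sup>2 / e + e * w\<^sup>2 - \<bar>2 * B * w\<bar>"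
        using e by (simp add: power2_diff abs_mult add_divide_distrib diff_divide_distrib power_mult_distrib)
          (simp add: power2_eq_square)
      then show ?thesis using s by linarith
    qed
    have "D\<^sup>2 - w\<^sup>2 = B\<^sup>2 + 2 * B * w"
      by (simp add: D_def power2_eq_square algebra_simps)
    then have "\<bar>q z * (D\<^sup>2 - w\<^sup>2) / 2\<bar> = \<bar>q z\<bar> * \<bar>B\<^sup>2 + 2 * B * w\<bar> / 2"
      by (simp add: abs_mult)
    also have "\<dots> \<le> Q * (B\<^sup>2 + (B\<^sup>2 / e + e * w\<^sup>2)) / 2"
      using Q[of z] Q0 young by (intro divide_right_mono mult_mono) (auto intro: order_trans[OF abs_triangle_ineq])
    finally have 3: "\<bar>q z * (D\<^sup>2 - w\<^sup>2) / 2\<bar> \<le> Q * (B\<^sup>2 + (B\<^sup>2 / e + e * w\<^sup>2)) / 2" .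
    have "v (z + B + w) - v z - p z * B - p z * w - q z * w\<^sup>2 / 2 =
      (v (z + D) - v z - p z * D - q z * D\<^sup>2 / 2) + q z * (D\<^sup>2 - w\<^sup>2) / 2"
      by (simp add: D_def algebra_simps diff_divide_distrib)
    then have "\<bar>v (z + B + w) - v z - p z * B - p z * w - q z * w\<^sup>2 / 2\<bar> \<le>
      e * (B\<^sup>2 + w\<^sup>2) + 4 * K * ((B\<^sup>2)\<^sup>2 + (w\<^sup>2)\<^sup>2) + Q * (B\<^sup>2 + (B\<^sup>2 / e + e * w\<^sup>2)) / 2"
      using 1 2 3 by linarith
    also have "\<dots> = e * (1 + Q / 2) * w\<^sup>2 + (B\<^sup>2 * (e + Q / 2 + Q / (2 * e)) + 4 * K * (B\<^sup>2)\<^sup>2) + 4 * K * w ^ 4"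
      using e by (simp add: field_simps power2_eq_square power4_eq_xxxx)
    also have "\<dots> \<le> \<eta> * w\<^sup>2 + (C\<^sup>2 * h\<^sup>2 * (e + Q / 2 + Q / (2 * e)) + 4 * K * (C ^ 4 * h\<^sup>2)) + c * w ^ 4"
    proof (intro add_mono mult_right_mono mult_left_mono)
      have "e * (1 + Q / 2) \<le> e * (1 + Q)" using e Q0 by (intro mult_left_mono) auto
      then show "e * (1 + Q / 2) \<le> \<eta>" using Q0 by (simp add: e_def)
    qed (use B2 B4 c1 e Q0 K in auto)
    also have "\<dots> \<le> \<eta> * w\<^sup>2 + c * h\<^sup>2 + c * w ^ 4"
    proof -
      have "C\<^sup>2 * h\<^sup>2 * (e + Q / 2 + Q / (2 * e)) + 4 * K * (C ^ 4 * h\<^sup>2) = (c - 4 * K) * h\<^sup>2"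
        by (simp add: c_def algebra_simps)
      also have "\<dots> \<le> c * h\<^sup>2" using K by (intro mult_right_mono) auto
      finally show ?thesis by simp
    qed
    finally show ?thesis by (simp add: algebra_simps)
  qed
  moreover have "c \<ge> 0" using c1 K by linarith
  ultimately show thesis using that by blast
qed

section \<open>Brownian increments\<close>

context brownian_motion
begin

lemma W_measurable: "0 \<le> t \<Longrightarrow> W t \<in> borel_measurable M"
  using W_adapted[of t] sets_Fil[of t] space_F[of t] by (auto simp: measurable_def)

lemma Fil_measurable_mono:
  assumes "s \<le> t" "Y \<in> measurable (Fil s) N"
  shows "Y \<in> measurable (Fil t) N"
  using assms sets_F_mono[of s t] space_F by (auto simp: measurable_def)

lemma Fil_measurable_M:
  assumes "Y \<in> measurable (Fil s) N"
  shows "Y \<in> measurable M N"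
  using assms sets_Fil[of s] space_F by (auto simp: measurable_def)

lemma increment_even_moment:
  assumes "0 \<le> s" "s < t"
  shows "has_bochner_integral M (\<lambda>\<omega>. (W t \<omega> - W s \<omega>) ^ (2 * k))
    (fact (2 * k) / ((2 / (t - s)) ^ k * fact k))"
proof -
  have [simp]: "sqrt (t - s) > 0" "(sqrt (t - s))\<^sup>2 = t - s" using assms by auto
  note D = W_normal[OF assms]
  have m: "has_bochner_integral lborel (\<lambda>x. normal_density 0 (sqrt (t - s)) x * x ^ (2 * k))
    (fact (2 * k) / ((2 / (t - s)) ^ k * fact k))"
    using normal_moment_even[of "sqrt (t - s)" 0 k] assms by simp
  have "integrable M (\<lambda>\<omega>. (W t \<omega> - W s \<omega>) ^ (2 * k))"
    using distributed_integrable[OF D, of "\<lambda>x. x ^ (2 * k)"] integrable.intros[OF m] by simp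
  moreover have "expectation (\<lambda>\<omega>. (W t \<omega> - W s \<omega>) ^ (2 * k)) = fact (2 * k) / ((2 / (t - s)) ^ k * fact k)"
    using distributed_integral[OF D, of "\<lambda>x. x ^ (2 * k)"] has_bochner_integral_integral_eq[OF m] by simp
  ultimately show ?thesis by (simp add: has_bochner_integral_iff)
qed

lemma increment_mean:
  assumes "0 \<le> s" "s < t"
  shows "has_bochner_integral M (\<lambda>\<omega>. W t \<omega> - W s \<omega>) 0"
proof -
  have [simp]: "sqrt (t - s) > 0" using assms by auto
  note D = W_normal[OF assms]
  have m: "has_bochner_integral lborel (\<lambda>x. normal_density 0 (sqrt (t - s)) x * x) 0"
    using normal_moment_odd[of "sqrt (t - s)" 0 0] assms by simp
  have "integrable M (\<lambda>\<omega>. W t \<omega> - W s \<omega>)"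
    using distributed_integrable[OF D, of "\<lambda>x. x"] integrable.intros[OF m] by simp
  moreover have "expectation (\<lambda>\<omega>. W t \<omega> - W s \<omega>) = 0"
    using distributed_integral[OF D, of "\<lambda>x. x"] has_bochner_integral_integral_eq[OF m] by simp
  ultimately show ?thesis by (simp add: has_bochner_integral_iff)
qed

text \<open>The increment is independent of the whole past, so a bounded factor that is known at time \<open>s\<close>
  can be pulled out of the expectation.\<close>

lemma increment_past_product:
  fixes Y :: "'w \<Rightarrow> real" and \<phi> :: "real \<Rightarrow> real"
  assumes "0 \<le> s" "s < t" and Y: "Y \<in> borel_measurable (Fil s)" and c: "\<And>\<omega>. \<bar>Y \<omega>\<bar> \<le> c"
    and \<phi>: "\<phi> \<in> borel_measurable borel" "has_bochner_integral M (\<lambda>\<omega>. \<phi> (W t \<omega> - W s \<omega>)) m"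
  shows "has_bochner_integral M (\<lambda>\<omega>. Y \<omega> * \<phi> (W t \<omega> - W s \<omega>)) (expectation Y * m)"
proof -
  define D where "D = (\<lambda>\<omega>. W t \<omega> - W s \<omega>)"
  have D[measurable]: "D \<in> borel_measurable M" unfolding D_def
    using W_measurable assms(1,2) by (intro borel_measurable_diff) auto
  have YM[measurable]: "Y \<in> borel_measurable M" using Fil_measurable_M[OF Y] .
  have "{Y -` A \<inter> space M | A. A \<in> sets borel} \<subseteq> sets (Fil s)"
    using Y space_F[of s] by (auto simp: measurable_def)
  then have "indep_set {Y -` A \<inter> space M | A. A \<in> sets borel} {D -` A \<inter> space M | A. A \<in> sets borel}"
    using W_indep[OF assms(1,2)] unfolding D_def indep_sets2_eq by blast
  moreover have "Int_stable {f -` A \<inter> space M | A. A \<in> sets borel}" for f :: "'w \<Rightarrow> real"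
    unfolding Int_stable_def by clarify (metis Int_assoc Int_left_commute Int_absorb sets.Int vimage_Int)
  ultimately have "indep_set (sigma_sets (space M) {Y -` A \<inter> space M | A. A \<in> sets borel})
     (sigma_sets (space M) {D -` A \<inter> space M | A. A \<in> sets borel})"
    by (intro indep_set_sigma_sets)
  then have "indep_var borel Y borel D" by (simp add: indep_var_eq)
  then have ind: "indep_var borel ((\<lambda>x. x) \<circ> Y) borel (\<phi> \<circ> D)"
    using \<phi>(1) by (intro indep_var_compose) auto
  have "integrable M Y" using c by (intro integrable_const_bound[of _ c]) auto
  then show ?thesis
    using indep_var_integrable[OF ind] indep_var_lebesgue_integral[OF ind] \<phi>(2)
    by (simp add: has_bochner_integral_iff D_def o_def)
qed

text \<open>The terms of first order in the noise have mean zero and its square has mean \<open>h\<close>, even on an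
  event \<open>A\<close> of the past. The drift displacement \<open>B\<close> depends on the path up to time \<open>s + h\<close>; it may
  be correlated with the noise because only its size enters the error.\<close>

lemma one_step_estimate:
  assumes v: "smooth_test v p q" and "\<eta> > 0" "C \<ge> 0"
  obtains c where "c \<ge> 0"
    "\<And>s h A Z B. 0 \<le> s \<Longrightarrow> 0 < h \<Longrightarrow> h \<le> 1 \<Longrightarrow> {\<omega>\<in>space M. A \<omega>} \<in> sets (Fil s) \<Longrightarrow>
      Z \<in> borel_measurable (Fil s) \<Longrightarrow> B \<in> borel_measurable M \<Longrightarrow> (\<And>\<omega>. \<bar>B \<omega>\<bar> \<le> C * h) \<Longrightarrow>
      \<bar>expectation (\<lambda>\<omega>. of_bool (A \<omega>) * (v (Z \<omega> + B \<omega> + \<sigma> * (W (s + h) \<omega> - W s \<omega>)) - v (Z \<omega>)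
         - p (Z \<omega>) * B \<omega> - h * \<sigma>\<^sup>2 / 2 * q (Z \<omega>)))\<bar> \<le> \<eta> * h + c * h\<^sup>2"
proof -
  define \<eta>' where "\<eta>' = \<eta> / (1 + \<sigma>\<^sup>2)"
  have s1: "1 + \<sigma>\<^sup>2 > 0" by (simp add: add_pos_nonneg)
  have e': "\<eta>' > 0" using assms(2) s1 by (simp add: \<eta>'_def)
  obtain c where c: "c \<ge> 0" and exp: "\<And>z h B w. 0 \<le> h \<Longrightarrow> h \<le> 1 \<Longrightarrow> \<bar>B\<bar> \<le> C * h \<Longrightarrow>
      \<bar>v (z + B + w) - v z - p z * B - p z * w - q z * w\<^sup>2 / 2\<bar> \<le> \<eta>' * w\<^sup>2 + c * (h\<^sup>2 + w ^ 4)"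
    using second_order_expansion[OF v e' assms(3)] by metis
  obtain V where V: "\<And>x. \<bar>v x\<bar> \<le> V" and P: "\<And>x. \<bar>p x\<bar> \<le> V" and Q: "\<And>x. \<bar>q x\<bar> \<le> V"
    using smooth_test_bound[OF v] by metis
  define P Q where "P = V" and "Q = V"
  note P = P[folded P_def] and Q = Q[folded Q_def]
  note cont = smooth_test_continuous[OF v]
  have [measurable]: "v \<in> borel_measurable borel" "p \<in> borel_measurable borel" "q \<in> borel_measurable borel"
    using cont by (auto intro: borel_measurable_continuous_onI)
  have "\<bar>expectation (\<lambda>\<omega>. of_bool (A \<omega>) * (v (Z \<omega> + B \<omega> + \<sigma> * (W (s + h) \<omega> - W s \<omega>)) - v (Z \<omega>)
         - p (Z \<omega>) * B \<omega> - h * \<sigma>\<^sup>2 / 2 * q (Z \<omega>)))\<bar> \<le> \<eta> * h + c * (1 + 3 * \<sigma> ^ 4) * h\<^sup>2"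
    if s: "0 \<le> s" and h: "0 < h" "h \<le> 1" and A: "{\<omega>\<in>space M. A \<omega>} \<in> sets (Fil s)"
      and Z: "Z \<in> borel_measurable (Fil s)" and B[measurable]: "B \<in> borel_measurable M"
      and BC: "\<And>\<omega>. \<bar>B \<omega>\<bar> \<le> C * h" for s h A Z B
  proof -
    define D where "D = (\<lambda>\<omega>. W (s + h) \<omega> - W s \<omega>)"
    have sh: "s < s + h" using h by simp
    have [measurable]: "D \<in> borel_measurable M" unfolding D_def
      using W_measurable s h by (intro borel_measurable_diff) auto
    have [measurable]: "Z \<in> borel_measurable M" by (rule Fil_measurable_M[OF Z])
    have A': "Measurable.pred (Fil s) A" using A space_F[of s] by (simp add: pred_def)
    have AM[measurable]: "Measurable.pred M A" by (rule Fil_measurable_M[OF A'])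
    have m1: "has_bochner_integral M D 0" unfolding D_def by (rule increment_mean[OF s sh])
    have m2: "has_bochner_integral M (\<lambda>\<omega>. (D \<omega>)\<^sup>2) h" unfolding D_def
      using increment_even_moment[OF s sh, of 1] by simp
    have m4: "has_bochner_integral M (\<lambda>\<omega>. (D \<omega>) ^ 4) (3 * h\<^sup>2)" unfolding D_def
      using increment_even_moment[OF s sh, of 2] h by (simp add: fact_numeral field_simps power2_eq_square)
    define Y1 where "Y1 = (\<lambda>\<omega>. of_bool (A \<omega>) * p (Z \<omega>))"
    define Y2 where "Y2 = (\<lambda>\<omega>. of_bool (A \<omega>) * q (Z \<omega>))"
    have Y1: "Y1 \<in> borel_measurable (Fil s)" "\<And>\<omega>. \<bar>Y1 \<omega>\<bar> \<le> P"
      unfolding Y1_def using A' Z P by (auto simp: abs_mult intro: order_trans[OF abs_ge_zero P])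
    have Y2: "Y2 \<in> borel_measurable (Fil s)" "\<And>\<omega>. \<bar>Y2 \<omega>\<bar> \<le> Q"
      unfolding Y2_def using A' Z Q by (auto simp: abs_mult intro: order_trans[OF abs_ge_zero Q])
    have i1: "has_bochner_integral M (\<lambda>\<omega>. Y1 \<omega> * D \<omega>) (expectation Y1 * 0)"
      using increment_past_product[OF s sh Y1, of "\<lambda>x. x" 0] m1 by (simp add: D_def)
    have i2: "has_bochner_integral M (\<lambda>\<omega>. Y2 \<omega> * (D \<omega>)\<^sup>2) (expectation Y2 * h)"
      using increment_past_product[OF s sh Y2, of "\<lambda>x. x\<^sup>2" h] m2 by (simp add: D_def)
    have iY2: "integrable M Y2"
      using Y2 Fil_measurable_M[OF Y2(1)] by (intro integrable_const_bound[of _ Q]) auto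
    define E where "E = (\<lambda>\<omega>. of_bool (A \<omega>) * (v (Z \<omega> + B \<omega> + \<sigma> * D \<omega>) - v (Z \<omega>)
       - p (Z \<omega>) * B \<omega> - h * \<sigma>\<^sup>2 / 2 * q (Z \<omega>)))"
    \<comment> \<open>\<open>G\<close> subtracts from \<open>E\<close> terms whose expectations cancel and is the remainder of the expansion\<close>
    define G where "G = (\<lambda>\<omega>. E \<omega> - \<sigma> * (Y1 \<omega> * D \<omega>) - \<sigma>\<^sup>2 / 2 * (Y2 \<omega> * (D \<omega>)\<^sup>2) + h * \<sigma>\<^sup>2 / 2 * Y2 \<omega>)"
    have Eb: "\<bar>E \<omega>\<bar> \<le> V + V + P * (C * h) + h * \<sigma>\<^sup>2 / 2 * Q" for \<omega>
    proof -
      have "\<bar>p (Z \<omega>) * B \<omega>\<bar> \<le> P * (C * h)" "\<bar>h * \<sigma>\<^sup>2 / 2 * q (Z \<omega>)\<bar> \<le> h * \<sigma>\<^sup>2 / 2 * Q"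
        using P[of "Z \<omega>"] Q[of "Z \<omega>"] BC[of \<omega>] h
        by (auto simp: abs_mult intro!: mult_mono order_trans[OF abs_ge_zero P])
      then have "\<bar>v (Z \<omega> + B \<omega> + \<sigma> * D \<omega>) - v (Z \<omega>) - p (Z \<omega>) * B \<omega> - h * \<sigma>\<^sup>2 / 2 * q (Z \<omega>)\<bar>
        \<le> V + V + P * (C * h) + h * \<sigma>\<^sup>2 / 2 * Q"
        using V[of "Z \<omega> + B \<omega> + \<sigma> * D \<omega>"] V[of "Z \<omega>"] by linarith
      then show ?thesis by (auto simp: E_def)
    qed
    have iE: "integrable M E"
      using Eb unfolding E_def by (intro integrable_const_bound[of _ "V + V + P * (C * h) + h * \<sigma>\<^sup>2 / 2 * Q"]) auto
    have iG: "integrable M G"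
      unfolding G_def using iE i1 i2 iY2 by (auto simp: has_bochner_integral_iff)
    have "expectation G = expectation E - \<sigma> * (expectation Y1 * 0) - \<sigma>\<^sup>2 / 2 * (expectation Y2 * h) + h * \<sigma>\<^sup>2 / 2 * expectation Y2"
      unfolding G_def using iE i1 i2 iY2 by (simp add: has_bochner_integral_iff)
    then have eq: "expectation E = expectation G" by simp
    have Gb: "\<bar>G \<omega>\<bar> \<le> \<eta>' * \<sigma>\<^sup>2 * (D \<omega>)\<^sup>2 + c * (h\<^sup>2 + \<sigma> ^ 4 * (D \<omega>) ^ 4)" for \<omega>
    proof -
      have "G \<omega> = of_bool (A \<omega>) * (v (Z \<omega> + B \<omega> + \<sigma> * D \<omega>) - v (Z \<omega>) - p (Z \<omega>) * B \<omega>
         - p (Z \<omega>) * (\<sigma> * D \<omega>) - q (Z \<omega>) * (\<sigma> * D \<omega>)\<^sup>2 / 2)"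
        by (simp add: G_def E_def Y1_def Y2_def algebra_simps power_mult_distrib)
      then have "\<bar>G \<omega>\<bar> \<le> \<bar>v (Z \<omega> + B \<omega> + \<sigma> * D \<omega>) - v (Z \<omega>) - p (Z \<omega>) * B \<omega>
         - p (Z \<omega>) * (\<sigma> * D \<omega>) - q (Z \<omega>) * (\<sigma> * D \<omega>)\<^sup>2 / 2\<bar>"
        by auto
      also have "\<dots> \<le> \<eta>' * (\<sigma> * D \<omega>)\<^sup>2 + c * (h\<^sup>2 + (\<sigma> * D \<omega>) ^ 4)"
        using exp[of h "B \<omega>" "Z \<omega>" "\<sigma> * D \<omega>"] h BC[of \<omega>] by simp
      finally show ?thesis by (simp add: power_mult_distrib algebra_simps)
    qed
    have iR: "has_bochner_integral M (\<lambda>\<omega>. \<eta>' * \<sigma>\<^sup>2 * (D \<omega>)\<^sup>2 + c * (h\<^sup>2 + \<sigma> ^ 4 * (D \<omega>) ^ 4))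
      (\<eta>' * \<sigma>\<^sup>2 * h + c * (h\<^sup>2 + \<sigma> ^ 4 * (3 * h\<^sup>2)))"
      using m2 m4 by (auto simp: has_bochner_integral_iff prob_space)
    have "\<bar>expectation G\<bar> \<le> expectation (\<lambda>\<omega>. \<bar>G \<omega>\<bar>)" by (rule integral_abs_bound)
    also have "\<dots> \<le> expectation (\<lambda>\<omega>. \<eta>' * \<sigma>\<^sup>2 * (D \<omega>)\<^sup>2 + c * (h\<^sup>2 + \<sigma> ^ 4 * (D \<omega>) ^ 4))"
      using iR iG Gb by (intro integral_mono) (auto simp: has_bochner_integral_iff)
    also have "\<dots> = \<eta>' * \<sigma>\<^sup>2 * h + c * (h\<^sup>2 + \<sigma> ^ 4 * (3 * h\<^sup>2))"
      using iR by (simp add: has_bochner_integral_iff)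
    also have "\<dots> \<le> \<eta> * h + c * (1 + 3 * \<sigma> ^ 4) * h\<^sup>2"
    proof -
      have "\<eta>' * \<sigma>\<^sup>2 \<le> \<eta>' * (1 + \<sigma>\<^sup>2)" using e' by (intro mult_left_mono) auto
      also have "\<dots> = \<eta>" using s1 by (simp add: \<eta>'_def)
      finally have "\<eta>' * \<sigma>\<^sup>2 * h \<le> \<eta> * h" using h by (intro mult_right_mono) auto
      then show ?thesis by (simp add: algebra_simps)
    qed
    finally show ?thesis using eq by (simp add: E_def D_def)
  qed
  moreover have "c * (1 + 3 * \<sigma> ^ 4) \<ge> 0" using c by (simp add: zero_le_even_power)
  ultimately show thesis using that by blast
qed

end

section \<open>The solution on a time grid\<close>

locale additive_noise_sde = brownian_motion M Fil W
  for M :: "'w measure" and Fil :: "real \<Rightarrow> 'w measure" and W :: "real \<Rightarrow> 'w \<Rightarrow> real" +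
  fixes X :: "real \<Rightarrow> 'w \<Rightarrow> real" and \<beta> :: "real \<Rightarrow> real" and \<sigma> x\<^sub>0 :: real
  assumes solution: "sde_solution M Fil W (\<lambda>t \<omega> y. \<beta> y) \<sigma> x\<^sub>0 X"
    and drift_continuous: "continuous_on UNIV \<beta>"
begin

text \<open>The almost sure properties of a path from which all pathwise statements are derived.\<close>

definition regular :: "'w \<Rightarrow> bool" where
  "regular \<omega> \<longleftrightarrow> X 0 \<omega> = x\<^sub>0 \<and> continuous_on {0..} (\<lambda>t. X t \<omega>) \<and>
    (\<forall>t\<ge>0. ((\<lambda>s. \<beta> (X s \<omega>)) has_integral (X t \<omega> - x\<^sub>0 - \<sigma> * W t \<omega>)) {0..t})"

lemma AE_regular: "AE \<omega> in M. regular \<omega>"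
proof -
  have "AE \<omega> in M. continuous_on {0..} (\<lambda>t. X t \<omega>)"
    and "AE \<omega> in M. \<forall>t\<ge>0. set_integrable lborel {0..t} (\<lambda>s. \<beta> (X s \<omega>)) \<and>
      X t \<omega> = x\<^sub>0 + (LINT s:{0..t}|lborel. \<beta> (X s \<omega>)) + \<sigma> * W t \<omega>"
    using solution by (auto simp: sde_solution_def)
  then show ?thesis using W_start
  proof eventually_elim
    case (elim \<omega>)
    have I: "((\<lambda>s. \<beta> (X s \<omega>)) has_integral (X t \<omega> - x\<^sub>0 - \<sigma> * W t \<omega>)) {0..t}" if "t \<ge> 0" for t
    proof -
      from elim(2) that have "set_integrable lborel {0..t} (\<lambda>s. \<beta> (X s \<omega>))"
        and e: "X t \<omega> = x\<^sub>0 + (LINT s:{0..t}|lborel. \<beta> (X s \<omega>)) + \<sigma> * W t \<omega>" by auto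
      from has_integral_set_lebesgue[of "{0..t}" "\<lambda>s. \<beta> (X s \<omega>)"]
      have "((\<lambda>s. \<beta> (X s \<omega>)) has_integral (LINT s:{0..t}|lborel. \<beta> (X s \<omega>))) {0..t}"
        using set_borel_integral_eq_integral[OF \<open>set_integrable lborel {0..t} _\<close>] integrable_integral by metis
      then show ?thesis using e by simp
    qed
    have "X 0 \<omega> - x\<^sub>0 - \<sigma> * W 0 \<omega> = 0"
      using I[of 0] has_integral_unique[OF I[of 0]] by (metis box_real(2) has_integral_null content_real_eq_0 order_refl interval_cbox)
    then show ?case using elim I unfolding regular_def by simp
  qed
qed

definition grid :: "real \<Rightarrow> nat \<Rightarrow> nat \<Rightarrow> real" where
  "grid T n j = T * real j / real n"

definition noise :: "real \<Rightarrow> nat \<Rightarrow> nat \<Rightarrow> 'w \<Rightarrow> real" where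
  "noise T n j \<omega> = W (grid T n (Suc j)) \<omega> - W (grid T n j) \<omega>"

text \<open>The part of a grid step of the solution that is due to the drift. Defining it as a difference
  of adapted variables, instead of as the integral of the drift, makes its measurability
  immediate.\<close>

definition displacement :: "real \<Rightarrow> nat \<Rightarrow> nat \<Rightarrow> 'w \<Rightarrow> real" where
  "displacement T n j \<omega> = X (grid T n (Suc j)) \<omega> - X (grid T n j) \<omega> - \<sigma> * noise T n j \<omega>"

text \<open>The path has been seen inside \<open>(l, R)\<close> at all grid points up to the \<open>j\<close>-th, and its drift
  displacements have been of the expected size. The second condition is known at time \<open>t\<^sub>j\<close> and
  holds automatically on a fine grid, so it costs nothing in the limit; in exchange, an
  excursion between grid points into a region of large drift cannot cause a large step.\<close>

definition alive :: "real \<Rightarrow> real \<Rightarrow> real \<Rightarrow> real \<Rightarrow> nat \<Rightarrow> nat \<Rightarrow> 'w \<Rightarrow> bool" where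
  "alive C l R T n j \<omega> \<longleftrightarrow> (\<forall>i\<le>j. l < X (grid T n i) \<omega> \<and> X (grid T n i) \<omega> < R) \<and>
    (\<forall>i<j. \<bar>displacement T n i \<omega>\<bar> \<le> C * (T / real n))"

text \<open>The displacement of a step is known only at its end, where it may be too large even if the path
  was alive at the beginning. Clipping bounds it, and on a fine grid changes nothing while the path
  is alive.\<close>

definition clipped :: "real \<Rightarrow> real \<Rightarrow> nat \<Rightarrow> nat \<Rightarrow> 'w \<Rightarrow> real" where
  "clipped C T n j \<omega> = max (- (C * (T / real n))) (min (C * (T / real n)) (displacement T n j \<omega>))"

definition landing :: "real \<Rightarrow> real \<Rightarrow> nat \<Rightarrow> nat \<Rightarrow> 'w \<Rightarrow> real" where
  "landing C T n j \<omega> = X (grid T n j) \<omega> + clipped C T n j \<omega> + \<sigma> * noise T n j \<omega>"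

text \<open>The value of \<open>v\<close> at the end of the last step that starts alive, minus its value at the
  start, written as a sum over steps so that the expectation of each step can be taken.\<close>

definition gain :: "(real \<Rightarrow> real) \<Rightarrow> real \<Rightarrow> real \<Rightarrow> real \<Rightarrow> real \<Rightarrow> nat \<Rightarrow> 'w \<Rightarrow> real" where
  "gain v C l R T n \<omega> =
    (\<Sum>j<n. of_bool (alive C l R T n j \<omega>) * (v (landing C T n j \<omega>) - v (X (grid T n j) \<omega>)))"

text \<open>A Riemann sum for the integral of \<open>\<phi>\<close> along the path up to the exit from \<open>(l, R)\<close> or time \<open>T\<close>.
  For \<open>\<phi> = 1\<close> it is the exit time seen on the grid.\<close>

definition occupation :: "(real \<Rightarrow> real) \<Rightarrow> real \<Rightarrow> real \<Rightarrow> real \<Rightarrow> real \<Rightarrow> nat \<Rightarrow> 'w \<Rightarrow> real" where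
  "occupation \<phi> C l R T n \<omega> =
    (\<Sum>j<n. of_bool (alive C l R T n j \<omega>) * (T / real n * \<phi> (X (grid T n j) \<omega>)))"

abbreviation survival :: "real \<Rightarrow> real \<Rightarrow> real \<Rightarrow> real \<Rightarrow> nat \<Rightarrow> 'w \<Rightarrow> real" where
  "survival \<equiv> occupation (\<lambda>_. 1)"

lemma alive_antimono: "alive C l R T n j \<omega> \<Longrightarrow> i \<le> j \<Longrightarrow> alive C l R T n i \<omega>"
  unfolding alive_def by (meson le_trans less_le_trans)

lemma landing_eq:
  assumes "\<bar>displacement T n j \<omega>\<bar> \<le> C * (T / real n)"
  shows "landing C T n j \<omega> = X (grid T n (Suc j)) \<omega>"
  using assms unfolding landing_def clipped_def by (simp add: displacement_def abs_le_iff min_def max_def)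

lemma grid_0 [simp]: "grid T n 0 = 0"
  by (simp add: grid_def)

lemma grid_nonneg: "T \<ge> 0 \<Longrightarrow> grid T n j \<ge> 0"
  by (simp add: grid_def)

lemma grid_mono: "T \<ge> 0 \<Longrightarrow> i \<le> j \<Longrightarrow> grid T n i \<le> grid T n j"
  by (simp add: grid_def divide_right_mono mult_left_mono)

lemma grid_Suc: "grid T n (Suc j) = grid T n j + T / real n"
  by (simp add: grid_def algebra_simps add_divide_distrib)

lemma grid_le: "T \<ge> 0 \<Longrightarrow> j \<le> n \<Longrightarrow> grid T n j \<le> T"
proof (cases "n = 0")
  case False
  assume "T \<ge> 0" "j \<le> n"
  then have "grid T n j \<le> grid T n n" by (intro grid_mono)
  then show ?thesis using False by (simp add: grid_def)
qed (simp add: grid_def)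

text \<open>A path that is alive at \<open>t\<^sub>j\<close> was not clipped before, so the landing point of one step is the
  starting point of the next.\<close>

lemma gain_telescopes:
  obtains N where "N \<le> n" "\<And>j. j < N \<Longrightarrow> alive C l R T n j \<omega>" "N < n \<Longrightarrow> \<not> alive C l R T n N \<omega>"
    "gain v C l R T n \<omega> = v (case N of 0 \<Rightarrow> X 0 \<omega> | Suc j \<Rightarrow> landing C T n j \<omega>) - v (X 0 \<omega>)"
proof -
  let ?A = "\<lambda>j. alive C l R T n j \<omega>" and ?e = "\<lambda>N. case N of 0 \<Rightarrow> X 0 \<omega> | Suc j \<Rightarrow> landing C T n j \<omega>"
  have "\<exists>N\<le>k. (\<forall>j<N. ?A j) \<and> (N < k \<longrightarrow> \<not> ?A N) \<and>
    (\<Sum>j<k. of_bool (?A j) * (v (landing C T n j \<omega>) - v (X (grid T n j) \<omega>))) = v (?e N) - v (X 0 \<omega>)" for k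
  proof (induction k)
    case 0
    then show ?case by simp
  next
    case (Suc k)
    then obtain N where N: "N \<le> k" "\<forall>j<N. ?A j" "N < k \<longrightarrow> \<not> ?A N"
      and S: "(\<Sum>j<k. of_bool (?A j) * (v (landing C T n j \<omega>) - v (X (grid T n j) \<omega>))) = v (?e N) - v (X 0 \<omega>)"
      by auto
    show ?case
    proof (cases "?A k")
      case True
      then have "?A N" using N(1) by (rule alive_antimono)
      with N have Nk: "N = k" by auto
      have "?e k = X (grid T n k) \<omega>"
      proof (cases k)
        case (Suc i)
        then have "\<bar>displacement T n i \<omega>\<bar> \<le> C * (T / real n)" using True by (auto simp: alive_def)
        then show ?thesis using Suc landing_eq by simp
      qed simp
      then show ?thesis
        using True S N alive_antimono[OF True] by (intro exI[of _ "Suc k"]) (auto simp: Nk less_Suc_eq)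
    next
      case False
      then show ?thesis using S N by (intro exI[of _ N]) (auto simp: less_Suc_eq le_Suc_eq)
    qed
  qed
  from this[of n] that show thesis unfolding gain_def by blast
qed

lemma survival_le:
  assumes "T \<ge> 0" "J \<le> n" "J < n \<Longrightarrow> \<not> alive C l R T n J \<omega>"
  shows "survival C l R T n \<omega> \<le> grid T n J"
proof -
  have dead: "\<not> alive C l R T n j \<omega>" if "J \<le> j" "j < n" for j
    using that assms(3) alive_antimono by (meson le_less_trans)
  have "survival C l R T n \<omega> \<le> (\<Sum>j<n. if j < J then T / real n else 0)"
    unfolding occupation_def using dead assms(1) by (intro sum_mono) (auto simp: not_less)
  also have "\<dots> = (\<Sum>j<J. T / real n)"
    using assms(2) by (intro sum.mono_neutral_cong_right) auto
  also have "\<dots> = grid T n J" by (simp add: grid_def)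
  finally show ?thesis .
qed

lemma survival_ge:
  assumes "T \<ge> 0" "J \<le> n" "\<And>j. j < J \<Longrightarrow> alive C l R T n j \<omega>"
  shows "grid T n J \<le> survival C l R T n \<omega>"
proof -
  have "grid T n J = (\<Sum>j<J. T / real n)" by (simp add: grid_def)
  also have "\<dots> = (\<Sum>j<n. if j < J then T / real n else 0)"
    using assms(2) by (intro sum.mono_neutral_cong_left) auto
  also have "\<dots> \<le> survival C l R T n \<omega>"
    unfolding occupation_def using assms by (intro sum_mono) auto
  finally show ?thesis .
qed

lemma survival_nonneg: "T \<ge> 0 \<Longrightarrow> 0 \<le> survival C l R T n \<omega>"
  by (auto simp: occupation_def intro!: sum_nonneg)

lemma survival_le_horizon: "T \<ge> 0 \<Longrightarrow> survival C l R T n \<omega> \<le> T"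
  using survival_le[of T n n C l R \<omega>] grid_le[of T n n] by linarith

lemma X_grid_measurable: "T \<ge> 0 \<Longrightarrow> X (grid T n j) \<in> borel_measurable (Fil (grid T n j))"
  using solution grid_nonneg by (auto simp: sde_solution_def)

lemma displacement_measurable:
  assumes "T \<ge> 0"
  shows "displacement T n j \<in> borel_measurable (Fil (grid T n (Suc j)))"
proof -
  note mono = Fil_measurable_mono[OF grid_mono[OF assms, of j "Suc j" n]]
  have "X (grid T n j) \<in> borel_measurable (Fil (grid T n (Suc j)))"
    "W (grid T n j) \<in> borel_measurable (Fil (grid T n (Suc j)))"
    by (auto intro!: mono X_grid_measurable[OF assms] W_adapted grid_nonneg[OF assms])
  then show ?thesis
    using X_grid_measurable[OF assms] W_adapted grid_nonneg[OF assms]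
    unfolding displacement_def noise_def by measurable
qed

lemma alive_measurable:
  assumes "T \<ge> 0"
  shows "Measurable.pred (Fil (grid T n j)) (alive C l R T n j)"
proof -
  have [measurable]: "X (grid T n i) \<in> borel_measurable (Fil (grid T n j))" if "i \<le> j" for i
    using X_grid_measurable[OF assms] Fil_measurable_mono[OF grid_mono[OF assms that]] by blast
  have [measurable]: "displacement T n i \<in> borel_measurable (Fil (grid T n j))" if "i < j" for i
    using that by (intro Fil_measurable_mono[OF grid_mono[OF assms] displacement_measurable[OF assms]]) simp
  have "alive C l R T n j = (\<lambda>\<omega>. (\<forall>i\<in>{..j}. l < X (grid T n i) \<omega> \<and> X (grid T n i) \<omega> < R) \<and>
    (\<forall>i\<in>{..<j}. \<bar>displacement T n i \<omega>\<bar> \<le> C * (T / real n)))"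
    by (auto simp: alive_def fun_eq_iff)
  also have "Measurable.pred (Fil (grid T n j)) \<dots>"
    by (intro pred_intros_logic pred_intros_finite) auto
  finally show ?thesis .
qed

lemma grid_measurable_M:
  assumes "T \<ge> 0"
  shows "X (grid T n j) \<in> borel_measurable M" "clipped C T n j \<in> borel_measurable M"
    "landing C T n j \<in> borel_measurable M" "Measurable.pred M (alive C l R T n j)"
proof -
  have [measurable]: "X (grid T n j) \<in> borel_measurable M" "displacement T n j \<in> borel_measurable M"
    "W (grid T n j) \<in> borel_measurable M" "W (grid T n (Suc j)) \<in> borel_measurable M"
    using Fil_measurable_M X_grid_measurable[OF assms] displacement_measurable[OF assms] W_measurable
      grid_nonneg[OF assms] by blast+
  show "X (grid T n j) \<in> borel_measurable M" "clipped C T n j \<in> borel_measurable M"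
    "landing C T n j \<in> borel_measurable M"
    unfolding landing_def clipped_def noise_def by measurable
  show "Measurable.pred M (alive C l R T n j)"
    using Fil_measurable_M alive_measurable[OF assms] by blast
qed

lemma gain_measurable:
  assumes "T \<ge> 0" "v \<in> borel_measurable borel"
  shows "gain v C l R T n \<in> borel_measurable M"
  using assms grid_measurable_M[OF assms(1)] unfolding gain_def by measurable

lemma occupation_measurable:
  assumes "T \<ge> 0" "\<phi> \<in> borel_measurable borel"
  shows "occupation \<phi> C l R T n \<in> borel_measurable M"
  using assms grid_measurable_M[OF assms(1)] unfolding occupation_def by measurable

text \<open>The drift is continuous along a continuous path, hence uniformly continuous on \<open>[0, T]\<close>. The
  required fineness of the grid depends on the path.\<close>

lemma displacement_close:
  assumes "regular \<omega>" "T > 0" "\<eta> > 0"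
  shows "\<forall>\<^sub>F n in sequentially. \<forall>j<n. \<bar>displacement T n j \<omega> - T / real n * \<beta> (X (grid T n j) \<omega>)\<bar> \<le> \<eta> * (T / real n)"
proof -
  have cX: "continuous_on {0..} (\<lambda>t. X t \<omega>)" using assms by (simp add: regular_def)
  have c: "continuous_on {0..T} (\<lambda>s. \<beta> (X s \<omega>))"
    by (rule continuous_on_compose2[OF drift_continuous continuous_on_subset[OF cX]]) auto
  then have "uniformly_continuous_on {0..T} (\<lambda>s. \<beta> (X s \<omega>))"
    by (intro compact_uniformly_continuous) auto
  then obtain d where d: "d > 0" "\<And>s r. s \<in> {0..T} \<Longrightarrow> r \<in> {0..T} \<Longrightarrow> dist r s < d \<Longrightarrow>
      dist (\<beta> (X r \<omega>)) (\<beta> (X s \<omega>)) < \<eta>"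
    using assms(3) unfolding uniformly_continuous_on_def by metis
  have "(\<lambda>n. T / real n) \<longlonglongrightarrow> 0" by (rule lim_const_over_n)
  then have "\<forall>\<^sub>F n in sequentially. T / real n < d" using d(1) by (rule order_tendstoD)
  then show ?thesis
  proof (eventually_elim, intro allI impI)
    fix n j assume n: "T / real n < d" and j: "j < n"
    define s where "s = grid T n j"
    define t where "t = grid T n (Suc j)"
    have st: "0 \<le> s" "t = s + T / real n" "t \<le> T" "s \<le> t"
      using assms(2) j grid_nonneg[of T n j] grid_Suc[of T n j] grid_le[of T "Suc j" n] by (auto simp: s_def t_def)
    have I: "((\<lambda>s. \<beta> (X s \<omega>)) has_integral (X u \<omega> - x\<^sub>0 - \<sigma> * W u \<omega>)) {0..u}" if "u \<ge> 0" for u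
      using assms(1) that by (simp add: regular_def)
    have "(\<lambda>s. \<beta> (X s \<omega>)) integrable_on {s..t}"
      by (intro integrable_continuous_real continuous_on_subset[OF c]) (use st in auto)
    then obtain i where i: "((\<lambda>s. \<beta> (X s \<omega>)) has_integral i) {s..t}" by blast
    have "((\<lambda>s. \<beta> (X s \<omega>)) has_integral (X s \<omega> - x\<^sub>0 - \<sigma> * W s \<omega>) + i) {0..t}"
      using st I[of s] i by (intro has_integral_combine[of 0 s t]) auto
    then have i_eq: "i = displacement T n j \<omega>"
      using has_integral_unique[OF I[of t]] st by (force simp: displacement_def noise_def s_def t_def algebra_simps)
    have "((\<lambda>r. \<beta> (X r \<omega>) - \<beta> (X s \<omega>)) has_integral i - (t - s) *\<^sub>R \<beta> (X s \<omega>)) {s..t}"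
      using i has_integral_const_real[of "\<beta> (X s \<omega>)" s t] st by (intro has_integral_diff) auto
    moreover have "norm (\<beta> (X r \<omega>) - \<beta> (X s \<omega>)) \<le> \<eta>" if "r \<in> {s..t}" for r
      using d(2)[of s r] st n that by (simp add: dist_norm)
    ultimately have "norm (i - (t - s) *\<^sub>R \<beta> (X s \<omega>)) \<le> \<eta> * measure lborel {s..t}"
      using assms(3) by (intro has_integral_bound_real[where S = "{}"]) auto
    then show "\<bar>displacement T n j \<omega> - T / real n * \<beta> (X (grid T n j) \<omega>)\<bar> \<le> \<eta> * (T / real n)"
      using st i_eq by (simp add: s_def)
  qed
qed

lemma displacement_bounded:
  assumes "regular \<omega>" "T > 0" and C: "\<forall>y\<in>{l..R}. \<bar>\<beta> y\<bar> + 1 \<le> C"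
  shows "\<forall>\<^sub>F n in sequentially. \<forall>j<n. l \<le> X (grid T n j) \<omega> \<longrightarrow> X (grid T n j) \<omega> \<le> R \<longrightarrow>
    \<bar>displacement T n j \<omega>\<bar> \<le> C * (T / real n)"
  using displacement_close[OF assms(1,2), of 1, simplified]
proof (eventually_elim, intro allI impI)
  fix n j
  assume a: "\<forall>j<n. \<bar>displacement T n j \<omega> - T * \<beta> (X (grid T n j) \<omega>) / real n\<bar> \<le> T / real n" and j: "j < n"
    and X: "l \<le> X (grid T n j) \<omega>" "X (grid T n j) \<omega> \<le> R"
  have "\<bar>displacement T n j \<omega>\<bar> \<le> \<bar>T / real n * \<beta> (X (grid T n j) \<omega>)\<bar> + T / real n"
  proof -
    have "\<bar>displacement T n j \<omega> - T / real n * \<beta> (X (grid T n j) \<omega>)\<bar> \<le> T / real n"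
      using a j by simp
    then show ?thesis by linarith
  qed
  also have "\<dots> = (\<bar>\<beta> (X (grid T n j) \<omega>)\<bar> + 1) * (T / real n)"
    using assms(2) by (simp add: abs_mult algebra_simps add_divide_distrib)
  also have "\<dots> \<le> C * (T / real n)" using C X assms(2) by (intro mult_right_mono) auto
  finally show "\<bar>displacement T n j \<omega>\<bar> \<le> C * (T / real n)" .
qed

text \<open>On a fine grid the displacement condition in \<open>alive\<close> is satisfied, and then a path inside \<open>(l, R)\<close>
  up to time \<open>t\<close> is alive at all grid points up to \<open>t\<close>.\<close>

lemma survival_eventually_ge:
  assumes "regular \<omega>" "T > 0" and C: "\<forall>y\<in>{l..R}. \<bar>\<beta> y\<bar> + 1 \<le> C"
    and t: "0 \<le> t" "t \<le> T" and X: "\<And>s. 0 \<le> s \<Longrightarrow> s \<le> t \<Longrightarrow> l < X s \<omega> \<and> X s \<omega> < R"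
  shows "\<forall>\<^sub>F n in sequentially. t \<le> survival C l R T n \<omega>"
  using displacement_bounded[OF assms(1,2) C] eventually_gt_at_top[of 0]
proof eventually_elim
  case (elim n)
  have alive: "alive C l R T n j \<omega>" if "grid T n j \<le> t" "j < n" for j
    unfolding alive_def
  proof (intro conjI allI impI)
    fix i assume "i \<le> j"
    then have "grid T n i \<le> t" using grid_mono[of T i j n] assms(2) that by linarith
    then have "l < X (grid T n i) \<omega> \<and> X (grid T n i) \<omega> < R"
      using X grid_nonneg[of T n i] assms(2) by simp
    then show "l < X (grid T n i) \<omega>" "X (grid T n i) \<omega> < R" by auto
  next
    fix i assume "i < j"
    then have "grid T n i \<le> t" using grid_mono[of T i j n] assms(2) that by linarith
    then have "l < X (grid T n i) \<omega> \<and> X (grid T n i) \<omega> < R"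
      using X grid_nonneg[of T n i] assms(2) by simp
    then show "\<bar>displacement T n i \<omega>\<bar> \<le> C * (T / real n)" using elim(1) \<open>i < j\<close> that by auto
  qed
  \<comment> \<open>the number of grid points up to time \<open>t\<close>, except for the last one if \<open>t = T\<close>\<close>
  define J where "J = min n (Suc (nat \<lfloor>t * real n / T\<rfloor>))"
  have "grid T n j \<le> t" if "j < J" for j
  proof -
    have "real j \<le> t * real n / T"
      using that t assms(2) by (auto simp: J_def less_Suc_eq_le le_nat_iff le_floor_iff)
    then show ?thesis using assms(2) elim(2) by (simp add: grid_def field_simps)
  qed
  then have "grid T n J \<le> survival C l R T n \<omega>"
    using alive assms(2) by (intro survival_ge) (auto simp: J_def)
  moreover have "t \<le> grid T n J"
  proof (cases "J = n")
    case True
    then show ?thesis using t elim(2) by (simp add: grid_def)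
  next
    case False
    then have "J = Suc (nat \<lfloor>t * real n / T\<rfloor>)" by (auto simp: J_def min_def split: if_splits)
    then have "t * real n / T \<le> real J" using t assms(2) by (simp add: le_of_int_ceiling) linarith
    then show ?thesis using assms(2) elim(2) by (simp add: grid_def field_simps)
  qed
  ultimately show ?case by linarith
qed

text \<open>A path that only touches the level \<open>l\<close> may be missed by every grid. Strictly below \<open>l\<close> it spends
  an open set of times, which a fine grid meets; for this reason the lower bound on the hitting
  time of \<open>l'\<close> works with a level \<open>l > l'\<close>.\<close>

lemma early_grid_point:
  assumes "regular \<omega>" "l < x\<^sub>0" "0 \<le> s" "X s \<omega> < l" "T > 0" "s < T"
  shows "\<forall>\<^sub>F n in sequentially. \<exists>J<n. grid T n J \<le> s \<and> X (grid T n J) \<omega> < l"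
proof -
  have c: "continuous_on {0..} (\<lambda>t. X t \<omega>)" and X0: "X 0 \<omega> = x\<^sub>0"
    using assms(1) by (auto simp: regular_def)
  have "s \<noteq> 0" using X0 assms(2,4) by auto
  then have s: "s > 0" using assms(3) by simp
  obtain d where d: "d > 0" "\<And>r. r \<ge> 0 \<Longrightarrow> dist r s < d \<Longrightarrow> dist (X r \<omega>) (X s \<omega>) < l - X s \<omega>"
    using c assms(3,4) unfolding continuous_on_iff by (metis atLeast_iff diff_gt_0_iff_gt)
  have "(\<lambda>n. T / real n) \<longlonglongrightarrow> 0" by (rule lim_const_over_n)
  then have "\<forall>\<^sub>F n in sequentially. T / real n < d" using d(1) by (rule order_tendstoD)
  then show ?thesis using eventually_gt_at_top[of 0]
  proof eventually_elim
    case (elim n)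
    define J where "J = nat \<lfloor>s * real n / T\<rfloor>"
    have p: "0 \<le> s * real n / T" using s assms(5) by simp
    have 1: "real J \<le> s * real n / T" "s * real n / T < real J + 1" using p by (auto simp: J_def)
    then have 2: "grid T n J \<le> s" "s < grid T n J + T / real n"
      using assms(5) elim(2) by (auto simp: grid_def field_simps)
    have "real J < real n"
      using 1(1) assms(5,6) elim(2) by (smt (verit) mult_strict_right_mono of_nat_0_less_iff pos_divide_less_eq mult.commute)
    moreover have "dist (X (grid T n J) \<omega>) (X s \<omega>) < l - X s \<omega>"
      using 2 elim(1) assms(5) by (intro d(2)) (auto simp: dist_real_def grid_nonneg)
    ultimately show ?case using 2 by (intro exI[of _ J]) (auto simp: dist_real_def)
  qed
qed

lemma survival_eventually_le:
  assumes "regular \<omega>" "l < x\<^sub>0" "0 \<le> s" "X s \<omega> < l" "T > 0"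
  shows "\<forall>\<^sub>F n in sequentially. survival C l R T n \<omega> \<le> s"
proof (cases "s < T")
  case True
  from early_grid_point[OF assms True] show ?thesis
  proof eventually_elim
    case (elim n)
    then obtain J where J: "J < n" "grid T n J \<le> s" "X (grid T n J) \<omega> < l" by blast
    then have "\<not> alive C l R T n J \<omega>" by (auto simp: alive_def not_less intro!: exI[of _ J])
    then show ?case using survival_le[of T J n C l R \<omega>] J assms(5) by simp
  qed
next
  case False
  then show ?thesis using survival_le_horizon[of T C l R] assms(5) 
    by (intro always_eventually allI) (smt (verit))
qed

text \<open>On a fine grid the path is stopped by its position and not by its displacement. As it has stayed
  below \<open>R\<close>, it is stopped at a point below \<open>l\<close>.\<close>

lemma gain_eventually_le:
  assumes "regular \<omega>" "l < x\<^sub>0" "0 \<le> s" "X s \<omega> < l" "T > 0" "s < T"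
    and C: "\<forall>y\<in>{l..R}. \<bar>\<beta> y\<bar> + 1 \<le> C"
    and X: "\<And>r. 0 \<le> r \<Longrightarrow> r \<le> s \<Longrightarrow> X r \<omega> < R" and v: "mono v"
  shows "\<forall>\<^sub>F n in sequentially. gain v C l R T n \<omega> \<le> v l - v x\<^sub>0"
  using early_grid_point[OF assms(1-6)] displacement_bounded[OF assms(1,5) C]
proof eventually_elim
  case (elim n)
  then obtain J where J: "J < n" "grid T n J \<le> s" "X (grid T n J) \<omega> < l" by blast
  then have dead: "\<not> alive C l R T n J \<omega>" by (auto simp: alive_def not_less intro!: exI[of _ J])
  obtain N where N: "N \<le> n" "\<And>j. j < N \<Longrightarrow> alive C l R T n j \<omega>" "N < n \<Longrightarrow> \<not> alive C l R T n N \<omega>"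
    and g: "gain v C l R T n \<omega> = v (case N of 0 \<Rightarrow> X 0 \<omega> | Suc j \<Rightarrow> landing C T n j \<omega>) - v (X 0 \<omega>)"
    using gain_telescopes by blast
  have X0: "X 0 \<omega> = x\<^sub>0" using assms(1) by (simp add: regular_def)
  have NJ: "N \<le> J" using N(2)[of J] dead by force
  then have N': "N < n" "grid T n N \<le> s" using J grid_mono[of T N J n] assms(5) by auto
  have XR: "X (grid T n N) \<omega> < R" using X N' grid_nonneg[of T n N] assms(5) by simp
  have "N \<noteq> 0"
  proof
    assume "N = 0"
    then show False using N(3) N'(1) XR X0 assms(2) by (simp add: alive_def)
  qed
  then obtain i where i: "N = Suc i" by (cases N) auto
  have ai: "alive C l R T n i \<omega>" using N(2) i by simp
  then have "l < X (grid T n i) \<omega>" "X (grid T n i) \<omega> < R" by (auto simp: alive_def)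
  then have disp: "\<bar>displacement T n i \<omega>\<bar> \<le> C * (T / real n)" using elim(2) i N'(1) by auto
  have "X (grid T n N) \<omega> \<le> l"
  proof (rule ccontr)
    assume "\<not> X (grid T n N) \<omega> \<le> l"
    then have "alive C l R T n N \<omega>"
      using ai disp XR unfolding i alive_def by (auto simp: le_Suc_eq less_Suc_eq)
    then show False using N(3) N'(1) by simp
  qed
  then have "v (X (grid T n N) \<omega>) \<le> v l" using v by (rule monoD[rotated])
  then show ?case using g landing_eq[OF disp] X0 by (simp add: i)
qed

end

section \<open>Dynkin's formula and bounds on the hitting time\<close>

context additive_noise_sde
begin

lemma gain_bounded:
  assumes "\<And>y. \<bar>v y\<bar> \<le> K"
  shows "\<bar>gain v C l R T n \<omega>\<bar> \<le> 2 * K"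
proof -
  obtain N where "gain v C l R T n \<omega> = v (case N of 0 \<Rightarrow> X 0 \<omega> | Suc j \<Rightarrow> landing C T n j \<omega>) - v (X 0 \<omega>)"
    using gain_telescopes by metis
  then show ?thesis
    using assms[of "case N of 0 \<Rightarrow> X 0 \<omega> | Suc j \<Rightarrow> landing C T n j \<omega>"] assms[of "X 0 \<omega>"] by linarith
qed

lemma alive_sum_bounded:
  assumes "T \<ge> 0" "c \<ge> 0" "\<And>j. j < n \<Longrightarrow> alive C l R T n j \<omega> \<Longrightarrow> \<bar>f j\<bar> \<le> c * (T / real n)"
  shows "\<bar>\<Sum>j<n. of_bool (alive C l R T n j \<omega>) * f j\<bar> \<le> c * T"
proof -
  have "\<bar>\<Sum>j<n. of_bool (alive C l R T n j \<omega>) * f j\<bar> \<le> (\<Sum>j<n. c * (T / real n))"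
    using assms by (intro order_trans[OF sum_abs] sum_mono) auto
  also have "\<dots> \<le> c * T" using assms(1,2) by (cases "n = 0") auto
  finally show ?thesis .
qed

lemma alive_inside: "alive C l R T n j \<omega> \<Longrightarrow> X (grid T n j) \<omega> \<in> {l<..<R}"
  by (simp add: alive_def)

lemma occupation_bounded:
  assumes "T \<ge> 0" "c \<ge> 0" "\<And>y. y \<in> {l<..<R} \<Longrightarrow> \<bar>\<phi> y\<bar> \<le> c"
  shows "\<bar>occupation \<phi> C l R T n \<omega>\<bar> \<le> c * T"
  unfolding occupation_def
proof (rule alive_sum_bounded)
  fix j assume "alive C l R T n j \<omega>"
  then have "\<bar>\<phi> (X (grid T n j) \<omega>)\<bar> \<le> c" using assms(3) alive_inside by blast
  then have "\<bar>\<phi> (X (grid T n j) \<omega>)\<bar> * (T / real n) \<le> c * (T / real n)"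
    using assms(1) by (intro mult_right_mono) auto
  then show "\<bar>T / real n * \<phi> (X (grid T n j) \<omega>)\<bar> \<le> c * (T / real n)"
    using assms(1) by (simp add: abs_mult mult.commute)
qed (use assms in auto)

lemma occupation_mono:
  assumes "T \<ge> 0" "\<And>y. y \<in> {l<..<R} \<Longrightarrow> \<phi> y \<le> \<psi> y"
  shows "occupation \<phi> C l R T n \<omega> \<le> occupation \<psi> C l R T n \<omega>"
  unfolding occupation_def
proof (rule sum_mono)
  fix j
  show "of_bool (alive C l R T n j \<omega>) * (T / real n * \<phi> (X (grid T n j) \<omega>))
    \<le> of_bool (alive C l R T n j \<omega>) * (T / real n * \<psi> (X (grid T n j) \<omega>))"
    using assms alive_inside[of C l R T n j \<omega>] by (auto intro!: divide_right_mono mult_left_mono)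
qed

lemma clipped_bound: "C \<ge> 0 \<Longrightarrow> T \<ge> 0 \<Longrightarrow> \<bar>clipped C T n j \<omega>\<bar> \<le> C * (T / real n)"
  unfolding clipped_def by (simp add: abs_le_iff)

lemma clipped_close:
  assumes "regular \<omega>" "T > 0" and C: "\<forall>y\<in>{l..R}. \<bar>\<beta> y\<bar> + 1 \<le> C" and "\<eta> > 0"
  shows "\<forall>\<^sub>F n in sequentially. \<forall>j<n. alive C l R T n j \<omega> \<longrightarrow>
    \<bar>clipped C T n j \<omega> - T / real n * \<beta> (X (grid T n j) \<omega>)\<bar> \<le> \<eta> * (T / real n)"
  using displacement_bounded[OF assms(1-3)] displacement_close[OF assms(1,2,4)]
proof eventually_elim
  case (elim n)
  show ?case
  proof (intro allI impI)
    fix j assume j: "j < n" "alive C l R T n j \<omega>"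
    have "\<bar>displacement T n j \<omega>\<bar> \<le> C * (T / real n)"
      using elim(1) j(1) alive_inside[OF j(2)] by auto
    then have "clipped C T n j \<omega> = displacement T n j \<omega>"
      by (simp add: clipped_def abs_le_iff min_def max_def)
    then show "\<bar>clipped C T n j \<omega> - T / real n * \<beta> (X (grid T n j) \<omega>)\<bar> \<le> \<eta> * (T / real n)"
      using elim(2) j(1) by simp
  qed
qed

text \<open>There are \<open>n\<close> steps of length \<open>T / n\<close>, so errors of \<open>\<eta> T / n\<close> and \<open>c (T / n)\<^sup>2\<close> per step sum up to
  \<open>\<eta> T + c T\<^sup>2 / n\<close>, with \<open>\<eta>\<close> arbitrary.\<close>

lemma martingale_part_limit:
  assumes v: "smooth_test v p q" and T: "T > 0" and C: "C \<ge> 0"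
  shows "(\<lambda>n. \<Sum>j<n. expectation (\<lambda>\<omega>. of_bool (alive C l R T n j \<omega>) * (v (landing C T n j \<omega>) - v (X (grid T n j) \<omega>)
    - p (X (grid T n j) \<omega>) * clipped C T n j \<omega> - T / real n * \<sigma>\<^sup>2 / 2 * q (X (grid T n j) \<omega>)))) \<longlonglongrightarrow> 0"
    (is "(\<lambda>n. \<Sum>j<n. ?e n j) \<longlonglongrightarrow> 0")
proof (rule tendstoI)
  fix e :: real assume e: "e > 0"
  define \<eta> where "\<eta> = e / (2 * T)"
  have \<eta>: "\<eta> > 0" using e T by (simp add: \<eta>_def)
  show "\<forall>\<^sub>F n in sequentially. dist (\<Sum>j<n. ?e n j) 0 < e"
  proof (rule one_step_estimate[OF v \<eta> C, where \<sigma> = \<sigma>])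
    fix c :: real assume c: "c \<ge> 0" and est:
      "\<And>s h A Z B. 0 \<le> s \<Longrightarrow> 0 < h \<Longrightarrow> h \<le> 1 \<Longrightarrow> {\<omega>\<in>space M. A \<omega>} \<in> sets (Fil s) \<Longrightarrow>
        Z \<in> borel_measurable (Fil s) \<Longrightarrow> B \<in> borel_measurable M \<Longrightarrow> (\<And>\<omega>. \<bar>B \<omega>\<bar> \<le> C * h) \<Longrightarrow>
        \<bar>expectation (\<lambda>\<omega>. of_bool (A \<omega>) * (v (Z \<omega> + B \<omega> + \<sigma> * (W (s + h) \<omega> - W s \<omega>)) - v (Z \<omega>)
           - p (Z \<omega>) * B \<omega> - h * \<sigma>\<^sup>2 / 2 * q (Z \<omega>)))\<bar> \<le> \<eta> * h + c * h\<^sup>2"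
    have "(\<lambda>n. c * T\<^sup>2 / real n) \<longlonglongrightarrow> 0" by (rule lim_const_over_n)
    then have "\<forall>\<^sub>F n in sequentially. c * T\<^sup>2 / real n < e / 2" using e by (intro order_tendstoD) auto
    moreover have "\<forall>\<^sub>F n in sequentially. T / real n < 1"
      by (rule order_tendstoD[OF lim_const_over_n]) simp
    ultimately show ?thesis using eventually_gt_at_top[of 0]
    proof eventually_elim
      case (elim n)
      have one: "\<bar>?e n j\<bar> \<le> \<eta> * (T / real n) + c * (T / real n)\<^sup>2" for j
      proof -
        have "{\<omega> \<in> space M. alive C l R T n j \<omega>} \<in> sets (Fil (grid T n j))"
          using alive_measurable[of T C l R n j] T space_F[of "grid T n j"] by (simp add: pred_def)
        then show ?thesis
          unfolding landing_def noise_def grid_Suc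
          using elim T by (intro est X_grid_measurable grid_measurable_M grid_nonneg clipped_bound[OF C]) auto
      qed
      have "\<bar>\<Sum>j<n. ?e n j\<bar> \<le> (\<Sum>j<n. \<eta> * (T / real n) + c * (T / real n)\<^sup>2)"
        by (intro order_trans[OF sum_abs] sum_mono one)
      also have "\<dots> = \<eta> * T + c * T\<^sup>2 / real n"
        using elim(3) by (simp add: field_simps power2_eq_square)
      also have "\<eta> * T = e / 2" using T by (simp add: \<eta>_def)
      also have "e / 2 + c * T\<^sup>2 / real n < e" using elim(1) by linarith
      finally show ?case by simp
    qed
  qed
qed

text \<open>Dynkin's formula for the exit from \<open>(l, R)\<close> before time \<open>T\<close>, in the limit of fine grids. The one
  step estimates leave the difference between the actual displacement and \<open>(T / n) \<beta>\<close> at the left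
  end of the step. It vanishes for each path as the grid is refined, and it is bounded because
  of the clipping, so dominated convergence removes it.\<close>

proposition grid_dynkin:
  assumes v: "smooth_test v p q" and T: "T > 0" and C: "C \<ge> 0" "\<forall>y\<in>{l..R}. \<bar>\<beta> y\<bar> + 1 \<le> C"
  shows "(\<lambda>n. expectation (\<lambda>\<omega>. gain v C l R T n \<omega>
    - occupation (\<lambda>y. \<beta> y * p y + \<sigma>\<^sup>2 / 2 * q y) C l R T n \<omega>)) \<longlonglongrightarrow> 0"
proof -
  obtain K where K: "\<And>x. \<bar>v x\<bar> \<le> K" "\<And>x. \<bar>p x\<bar> \<le> K" "\<And>x. \<bar>q x\<bar> \<le> K"
    using smooth_test_bound[OF v] by metis
  have K0: "K \<ge> 0" using K(1)[of 0] by linarith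
  note cont = smooth_test_continuous[OF v]
  have [measurable]: "v \<in> borel_measurable borel" "p \<in> borel_measurable borel" "q \<in> borel_measurable borel"
      "\<beta> \<in> borel_measurable borel"
    using cont drift_continuous by (auto intro: borel_measurable_continuous_onI)
  have T0: "T \<ge> 0" using T by simp
  note [measurable] = grid_measurable_M[OF T0]
  define first where "first = (\<lambda>n j \<omega>. of_bool (alive C l R T n j \<omega>) * (v (landing C T n j \<omega>) - v (X (grid T n j) \<omega>)
    - p (X (grid T n j) \<omega>) * clipped C T n j \<omega> - T / real n * \<sigma>\<^sup>2 / 2 * q (X (grid T n j) \<omega>)))"
  \<comment> \<open>what remains after replacing the clipped displacement by \<open>(T / n) \<beta>\<close>\<close>
  define rem where "rem = (\<lambda>n \<omega>. \<Sum>j<n. of_bool (alive C l R T n j \<omega>) *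
    (p (X (grid T n j) \<omega>) * (clipped C T n j \<omega> - T / real n * \<beta> (X (grid T n j) \<omega>))))"
  have split: "gain v C l R T n \<omega> - occupation (\<lambda>y. \<beta> y * p y + \<sigma>\<^sup>2 / 2 * q y) C l R T n \<omega>
    = (\<Sum>j<n. first n j \<omega>) + rem n \<omega>" for n \<omega>
    unfolding gain_def occupation_def first_def rem_def sum_subtractf[symmetric] sum.distrib[symmetric]
    by (intro sum.cong refl) (simp add: algebra_simps)
  have [measurable]: "first n j \<in> borel_measurable M" "rem n \<in> borel_measurable M" for n j
    unfolding first_def rem_def by measurable
  have first_b: "\<bar>first n j \<omega>\<bar> \<le> K + K + K * (C * (T / real n)) + T / real n * \<sigma>\<^sup>2 / 2 * K" for n j \<omega>
  proof -
    let ?x = "X (grid T n j) \<omega>"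
    have "\<bar>p ?x * clipped C T n j \<omega>\<bar> \<le> K * (C * (T / real n))"
      using K(2)[of ?x] clipped_bound[OF C(1) T0] K0 unfolding abs_mult by (intro mult_mono) auto
    moreover have "\<bar>T / real n * \<sigma>\<^sup>2 / 2 * q ?x\<bar> \<le> T / real n * \<sigma>\<^sup>2 / 2 * K"
      using K(3)[of ?x] T0 unfolding abs_mult by (intro mult_mono) auto
    ultimately have "\<bar>v (landing C T n j \<omega>) - v ?x - p ?x * clipped C T n j \<omega> - T / real n * \<sigma>\<^sup>2 / 2 * q ?x\<bar>
      \<le> K + K + K * (C * (T / real n)) + T / real n * \<sigma>\<^sup>2 / 2 * K"
      using K(1)[of ?x] K(1)[of "landing C T n j \<omega>"] by linarith
    then show ?thesis by (auto simp: first_def)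
  qed
  have first_i: "integrable M (first n j)" for n j
    by (rule integrable_const_bound[where B = "K + K + K * (C * (T / real n)) + T / real n * \<sigma>\<^sup>2 / 2 * K"])
      (use first_b in auto)
  have rem_b: "\<bar>rem n \<omega>\<bar> \<le> K * (2 * C) * T" for n \<omega>
    unfolding rem_def
  proof (rule alive_sum_bounded)
    fix j assume "alive C l R T n j \<omega>"
    then have "X (grid T n j) \<omega> \<in> {l..R}" using alive_inside by fastforce
    then have "\<bar>\<beta> (X (grid T n j) \<omega>)\<bar> + 1 \<le> C" using C(2) by blast
    then have "\<bar>\<beta> (X (grid T n j) \<omega>)\<bar> \<le> C" by simp
    then have "\<bar>T / real n * \<beta> (X (grid T n j) \<omega>)\<bar> \<le> C * (T / real n)"
      using T0 mult_left_mono[of _ C "T / real n"] by (simp add: abs_mult mult.commute[of C])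
    then have "\<bar>clipped C T n j \<omega> - T / real n * \<beta> (X (grid T n j) \<omega>)\<bar> \<le> 2 * C * (T / real n)"
      using clipped_bound[OF C(1) T0, of n j \<omega>] by linarith
    then have "\<bar>p (X (grid T n j) \<omega>)\<bar> * \<bar>clipped C T n j \<omega> - T / real n * \<beta> (X (grid T n j) \<omega>)\<bar>
      \<le> K * (2 * C * (T / real n))"
      using K(2) K0 by (intro mult_mono) auto
    then show "\<bar>p (X (grid T n j) \<omega>) * (clipped C T n j \<omega> - T / real n * \<beta> (X (grid T n j) \<omega>))\<bar>
      \<le> K * (2 * C) * (T / real n)"
      unfolding abs_mult by (simp only: mult.assoc)
  qed (use K0 C T in auto)
  have rem_i: "integrable M (rem n)" for n
    by (rule integrable_const_bound[where B = "K * (2 * C) * T"]) (use rem_b in auto)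
  have rem_lim: "(\<lambda>n. rem n \<omega>) \<longlonglongrightarrow> 0" if "regular \<omega>" for \<omega>
  proof (rule tendstoI)
    fix e :: real assume e: "e > 0"
    define \<eta> where "\<eta> = e / (2 * (K + 1) * T)"
    have \<eta>: "\<eta> > 0" using e T K0 by (simp add: \<eta>_def)
    show "\<forall>\<^sub>F n in sequentially. dist (rem n \<omega>) 0 < e"
      using clipped_close[OF that T C(2) \<eta>]
    proof eventually_elim
      case (elim n)
      have "\<bar>rem n \<omega>\<bar> \<le> (K + 1) * \<eta> * T"
        unfolding rem_def
      proof (rule alive_sum_bounded)
        fix j assume "j < n" "alive C l R T n j \<omega>"
        then have "\<bar>clipped C T n j \<omega> - T / real n * \<beta> (X (grid T n j) \<omega>)\<bar> \<le> \<eta> * (T / real n)"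
          using elim by blast
        then have "\<bar>p (X (grid T n j) \<omega>)\<bar> * \<bar>clipped C T n j \<omega> - T / real n * \<beta> (X (grid T n j) \<omega>)\<bar>
          \<le> (K + 1) * (\<eta> * (T / real n))"
          using K(2)[of "X (grid T n j) \<omega>"] K0 by (intro mult_mono) auto
        then show "\<bar>p (X (grid T n j) \<omega>) * (clipped C T n j \<omega> - T / real n * \<beta> (X (grid T n j) \<omega>))\<bar>
          \<le> (K + 1) * \<eta> * (T / real n)"
          unfolding abs_mult by (simp only: mult.assoc)
      qed (use K0 \<eta> T in auto)
      also have "\<dots> = e / 2"
      proof -
        have "k * (e / (2 * k * T)) * T = e / 2" if "k \<noteq> 0" for k
          using that T by simp
        from this[of "K + 1"] show ?thesis using K0 by (simp add: \<eta>_def)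
      qed
      finally show ?case using e by simp
    qed
  qed
  have "AE \<omega> in M. (\<lambda>n. rem n \<omega>) \<longlonglongrightarrow> 0"
    using AE_regular by (rule eventually_mono) (rule rem_lim)
  then have "(\<lambda>n. expectation (rem n)) \<longlonglongrightarrow> expectation (\<lambda>_. 0)"
    by (intro integral_dominated_convergence[where w = "\<lambda>_. K * (2 * C) * T"]) (use rem_b in auto)
  moreover have "(\<lambda>n. \<Sum>j<n. expectation (first n j)) \<longlonglongrightarrow> 0"
    unfolding first_def by (rule martingale_part_limit[OF v T C(1)])
  ultimately have "(\<lambda>n. (\<Sum>j<n. expectation (first n j)) + expectation (rem n)) \<longlonglongrightarrow> 0 + 0"
    by (intro tendsto_add) auto
  then show ?thesis
    unfolding split using first_i rem_i by simp
qed

lemma drift_bound: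
  obtains C where "C \<ge> 0" "\<forall>y\<in>{l..R}. \<bar>\<beta> y\<bar> + 1 \<le> C"
proof -
  have "bounded (\<beta> ` {l..R})"
    by (intro compact_imp_bounded compact_continuous_image continuous_on_subset[OF drift_continuous]) auto
  then obtain K where "\<forall>y\<in>{l..R}. \<bar>\<beta> y\<bar> \<le> K" by (auto simp: bounded_iff)
  then show thesis by (intro that[of "\<bar>K\<bar> + 1"]) auto
qed

lemma path_below:
  assumes "regular \<omega>"
  shows "\<forall>\<^sub>F m in sequentially. \<forall>r\<in>{0..t}. X r \<omega> < real (Suc m)"
proof -
  have "continuous_on {0..t} (\<lambda>t. X t \<omega>)"
    using assms continuous_on_subset by (fastforce simp: regular_def)
  then have "bounded ((\<lambda>t. X t \<omega>) ` {0..t})"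
    by (intro compact_imp_bounded compact_continuous_image) auto
  then obtain K where K: "\<forall>r\<in>{0..t}. \<bar>X r \<omega>\<bar> \<le> K" by (auto simp: bounded_iff)
  have "\<forall>\<^sub>F m in sequentially. K < real m"
    by (rule filterlim_at_top_dense[THEN iffD1, rule_format, OF filterlim_real_sequentially])
  then show ?thesis by (rule eventually_mono) (use K in force)
qed

lemma hitting_time_le:
  assumes "0 \<le> t" "X t \<omega> \<le> y"
  shows "hitting_time X y \<omega> \<le> ennreal t"
  unfolding hitting_time_def using assms by (intro INF_lower) auto

text \<open>If the generator maps \<open>v\<close> to \<open>- 1\<close>, Dynkin's formula turns the expected survival time into an
  expected decrease of \<open>v\<close>, which is at most \<open>c\<close>. Fatou's lemma is applied first to the grid and
  then to growing \<open>T = R\<close>; the right end of the interval disappears because a continuous path is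
  bounded on bounded time intervals. The measurable majorant \<open>Y\<close> is reused as the dominating
  function for the lower bound.\<close>

proposition hitting_time_upper_bound:
  fixes v p q :: "nat \<Rightarrow> real \<Rightarrow> real"
  assumes v: "\<And>m. smooth_test (v m) (p m) (q m)"
    and gen: "\<And>m y. l < y \<Longrightarrow> y < real (Suc m) \<Longrightarrow> \<beta> y * p m y + \<sigma>\<^sup>2 / 2 * q m y = -1"
    and c: "\<And>m y. v m x\<^sub>0 - v m y \<le> c"
  obtains Y where "Y \<in> borel_measurable M" "AE \<omega> in M. hitting_time X l \<omega> \<le> Y \<omega>"
    "(\<integral>\<^sup>+ \<omega>. Y \<omega> \<partial>M) \<le> ennreal c"
proof -
  have c0: "c \<ge> 0" using c[of 0 x\<^sub>0] by simp
  define T where "T m = real (Suc m)" for m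
  have T: "T m > 0" "T m \<ge> 0" for m by (auto simp: T_def)
  have "\<exists>C\<ge>0. \<forall>y\<in>{l..T m}. \<bar>\<beta> y\<bar> + 1 \<le> C" for m using drift_bound by metis
  then obtain C where C: "\<And>m. C m \<ge> 0" "\<And>m. \<forall>y\<in>{l..T m}. \<bar>\<beta> y\<bar> + 1 \<le> C m" by metis
  define S where "S m n = survival (C m) l (T m) (T m) n" for m n
  have Sm[measurable]: "S m n \<in> borel_measurable M" for m n
    unfolding S_def by (rule occupation_measurable[OF T(2)]) simp
  have S_b: "0 \<le> S m n \<omega>" "S m n \<omega> \<le> T m" for m n \<omega>
    using survival_nonneg survival_le_horizon T by (auto simp: S_def)
  have S_i: "integrable M (S m n)" for m n
    by (rule integrable_const_bound[where B = "T m"]) (use S_b in auto)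
  define Ym where "Ym m \<omega> = liminf (\<lambda>n. ennreal (S m n \<omega>))" for m \<omega>
  have Ym_m[measurable]: "Ym m \<in> borel_measurable M" for m unfolding Ym_def by measurable
  have Ym_int: "(\<integral>\<^sup>+ \<omega>. Ym m \<omega> \<partial>M) \<le> ennreal c" for m
  proof -
    let ?g = "\<lambda>n. gain (v m) (C m) l (T m) (T m) n"
    let ?o = "\<lambda>n. occupation (\<lambda>y. \<beta> y * p m y + \<sigma>\<^sup>2 / 2 * q m y) (C m) l (T m) (T m) n"
    have o: "?o n \<omega> = - S m n \<omega>" for n \<omega>
      unfolding S_def occupation_def sum_negf[symmetric]
    proof (intro sum.cong refl)
      fix j
      show "of_bool (alive (C m) l (T m) (T m) n j \<omega>) * (T m / real n * (\<beta> (X (grid (T m) n j) \<omega>) * p m (X (grid (T m) n j) \<omega>)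
          + \<sigma>\<^sup>2 / 2 * q m (X (grid (T m) n j) \<omega>))) = - (of_bool (alive (C m) l (T m) (T m) n j \<omega>) * (T m / real n * 1))"
      proof (cases "alive (C m) l (T m) (T m) n j \<omega>")
        case True
        then have "\<beta> (X (grid (T m) n j) \<omega>) * p m (X (grid (T m) n j) \<omega>)
          + \<sigma>\<^sup>2 / 2 * q m (X (grid (T m) n j) \<omega>) = - 1"
          using alive_inside by (intro gen) (auto simp: T_def)
        then show ?thesis by simp
      qed simp
    qed
    define e where "e n = expectation (\<lambda>\<omega>. ?g n \<omega> - ?o n \<omega>)" for n
    have e: "e \<longlonglongrightarrow> 0" unfolding e_def by (rule grid_dynkin[OF v T(1) C])
    obtain K where K: "\<And>x. \<bar>v m x\<bar> \<le> K" using smooth_test_bound[OF v[of m]] by metis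
    have [measurable]: "v m \<in> borel_measurable borel"
      using smooth_test_continuous[OF v[of m]] by (auto intro: borel_measurable_continuous_onI)
    have [measurable]: "?g n \<in> borel_measurable M" for n by (intro gain_measurable T) simp
    have gi: "integrable M (?g n)" for n
      by (rule integrable_const_bound[where B = "2 * K"]) (use gain_bounded[OF K] in auto)
    have "AE \<omega> in M. - c \<le> ?g n \<omega>" for n
      using AE_regular
    proof eventually_elim
      case (elim \<omega>)
      obtain y where "?g n \<omega> = v m y - v m (X 0 \<omega>)"
        using gain_telescopes by metis
      then show ?case using c[of m y] elim by (simp add: regular_def)
    qed
    then have gc: "- c \<le> expectation (?g n)" for n
      using integral_mono_AE[of M "\<lambda>_. - c" "?g n"] gi by (simp add: prob_space)
    have eS: "expectation (S m n) \<le> c + e n" for n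
      unfolding e_def o using gi[of n] S_i[of m n] gc[of n] by simp
    have "(\<integral>\<^sup>+ \<omega>. Ym m \<omega> \<partial>M) \<le> liminf (\<lambda>n. \<integral>\<^sup>+ \<omega>. ennreal (S m n \<omega>) \<partial>M)"
      unfolding Ym_def by (rule nn_integral_liminf) simp
    also have "\<dots> \<le> liminf (\<lambda>n. ennreal (c + e n))"
      using eS by (intro Liminf_mono always_eventually allI)
        (simp add: nn_integral_eq_integral[OF S_i] S_b ennreal_leI)
    also have "\<dots> = ennreal (c + 0)"
      by (intro lim_imp_Liminf tendsto_ennrealI tendsto_intros e) simp
    finally show ?thesis by simp
  qed
  define Y where "Y \<omega> = liminf (\<lambda>m. Ym m \<omega>)" for \<omega>
  have "AE \<omega> in M. hitting_time X l \<omega> \<le> Y \<omega>"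
    using AE_regular
  proof eventually_elim
    case (elim \<omega>)
    show ?case
    proof (rule dense_le)
      fix z assume z: "z < hitting_time X l \<omega>"
      then obtain t where t: "t \<ge> 0" "z = ennreal t"
        by (cases z rule: ennreal_cases) auto
      have above: "l < X s \<omega>" if "s \<in> {0..t}" for s
      proof (rule ccontr)
        assume "\<not> l < X s \<omega>"
        then have "hitting_time X l \<omega> \<le> ennreal s" using that by (intro hitting_time_le) auto
        also have "\<dots> \<le> z" using that t by (simp add: ennreal_leI)
        finally show False using z by simp
      qed
      have "\<forall>\<^sub>F m in sequentially. t \<le> real m"
        by (rule filterlim_at_top[THEN iffD1, rule_format, OF filterlim_real_sequentially])
      then have "\<forall>\<^sub>F m in sequentially. z \<le> Ym m \<omega>"
        using path_below[OF elim, of t]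
      proof eventually_elim
        case (elim m)
        have "\<forall>\<^sub>F n in sequentially. t \<le> S m n \<omega>"
          unfolding S_def using elim above t
          by (intro survival_eventually_ge[OF \<open>regular \<omega>\<close> T(1) C(2)]) (auto simp: T_def)
        then have "\<forall>\<^sub>F n in sequentially. z \<le> ennreal (S m n \<omega>)"
          unfolding t(2) by eventually_elim (rule ennreal_leI)
        then show ?case unfolding Ym_def by (rule Liminf_bounded)
      qed
      then show "z \<le> Y \<omega>" unfolding Y_def by (rule Liminf_bounded)
    qed
  qed
  moreover have "(\<integral>\<^sup>+ \<omega>. Y \<omega> \<partial>M) \<le> ennreal c"
  proof -
    have "(\<integral>\<^sup>+ \<omega>. Y \<omega> \<partial>M) \<le> liminf (\<lambda>m. \<integral>\<^sup>+ \<omega>. Ym m \<omega> \<partial>M)"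
      unfolding Y_def by (rule nn_integral_liminf) simp
    also have "\<dots> \<le> liminf (\<lambda>_. ennreal c)"
      using Ym_int by (intro Liminf_mono always_eventually allI)
    also have "\<dots> = ennreal c" by (simp add: Liminf_const)
    finally show ?thesis .
  qed
  moreover have "Y \<in> borel_measurable M" unfolding Y_def by measurable
  ultimately show thesis using that by blast
qed

text \<open>Now the survival time dominates the decrease of \<open>v\<close>, and the path must be shown to have come
  down to the level \<open>l\<close> when it is stopped. It may fail to do so because \<open>T\<close> is reached or because it
  exits through \<open>R\<close>. The excess of \<open>v\<close> at the stopping point over \<open>v l\<close> is therefore added to the
  survival time; it is bounded, and vanishes for large \<open>T = R\<close> once the path has hit \<open>l'\<close>. The
  reverse Fatou lemma, dominated by \<open>Y\<close>, concludes.\<close>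

proposition hitting_time_lower_bound:
  assumes v: "smooth_test v p q" and l: "l' < l" "l < x\<^sub>0"
    and gen: "\<And>y. l < y \<Longrightarrow> - 1 \<le> \<beta> y * p y + \<sigma>\<^sup>2 / 2 * q y"
    and Y[measurable]: "Y \<in> borel_measurable M" "AE \<omega> in M. hitting_time X l' \<omega> \<le> Y \<omega>"
      "(\<integral>\<^sup>+ \<omega>. Y \<omega> \<partial>M) < \<infinity>"
  shows "ennreal (v x\<^sub>0 - v l) \<le> (\<integral>\<^sup>+ \<omega>. hitting_time X l' \<omega> \<partial>M)"
proof -
  define T where "T m = real (Suc m)" for m
  have T: "T m > 0" "T m \<ge> 0" for m by (auto simp: T_def)
  have "\<exists>C\<ge>0. \<forall>y\<in>{l..T m}. \<bar>\<beta> y\<bar> + 1 \<le> C" for m using drift_bound by metis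
  then obtain C where C: "\<And>m. C m \<ge> 0" "\<And>m. \<forall>y\<in>{l..T m}. \<bar>\<beta> y\<bar> + 1 \<le> C m" by metis
  obtain K where K: "\<And>x. \<bar>v x\<bar> \<le> K" "\<And>x. \<bar>p x\<bar> \<le> K" "\<And>x. \<bar>q x\<bar> \<le> K"
    using smooth_test_bound[OF v] by metis
  have K0: "K \<ge> 0" using K(1)[of 0] by linarith
  have "mono v"
    using v unfolding smooth_test_def by (intro monoI DERIV_nonneg_imp_nondecreasing[of _ _ v]) blast+
  note cont = smooth_test_continuous[OF v]
  have [measurable]: "v \<in> borel_measurable borel" "p \<in> borel_measurable borel" "q \<in> borel_measurable borel"
      "\<beta> \<in> borel_measurable borel"
    using cont drift_continuous by (auto intro: borel_measurable_continuous_onI)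
  define S where "S m n = survival (C m) l (T m) (T m) n" for m n
  define g where "g m n = gain v (C m) l (T m) (T m) n" for m n
  define o' where "o' m n = occupation (\<lambda>y. \<beta> y * p y + \<sigma>\<^sup>2 / 2 * q y) (C m) l (T m) (T m) n" for m n
  have [measurable]: "S m n \<in> borel_measurable M" "g m n \<in> borel_measurable M" "o' m n \<in> borel_measurable M" for m n
    unfolding S_def g_def o'_def by (intro occupation_measurable gain_measurable T; measurable)+
  have S_b: "0 \<le> S m n \<omega>" "S m n \<omega> \<le> T m" for m n \<omega>
    using survival_nonneg survival_le_horizon T by (auto simp: S_def)
  have S_i: "integrable M (S m n)" for m n
    by (rule integrable_const_bound[where B = "T m"]) (use S_b in auto)
  have g_b: "\<bar>g m n \<omega>\<bar> \<le> 2 * K" for m n \<omega> using gain_bounded[OF K(1)] by (simp add: g_def)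
  have g_i: "integrable M (g m n)" for m n
    by (rule integrable_const_bound[where B = "2 * K"]) (use g_b in auto)
  have oS: "- S m n \<omega> \<le> o' m n \<omega>" for m n \<omega>
  proof -
    have "occupation (\<lambda>_. - 1) (C m) l (T m) (T m) n \<omega> \<le> o' m n \<omega>"
      unfolding o'_def using T gen by (intro occupation_mono) auto
    then show ?thesis by (simp add: S_def occupation_def sum_negf)
  qed
  have o_i: "integrable M (o' m n)" for m n
  proof (rule integrable_const_bound[where B = "(C m * K + \<sigma>\<^sup>2 / 2 * K) * T m"])
    have "\<bar>\<beta> y * p y + \<sigma>\<^sup>2 / 2 * q y\<bar> \<le> C m * K + \<sigma>\<^sup>2 / 2 * K" if "y \<in> {l<..<T m}" for y
    proof -
      have "\<bar>\<beta> y\<bar> + 1 \<le> C m" using C(2)[of m] that by simp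
      then have "\<bar>\<beta> y\<bar> \<le> C m" by simp
      then have "\<bar>\<beta> y * p y\<bar> \<le> C m * K" using K(2) C(1) unfolding abs_mult by (intro mult_mono) auto
      moreover have "\<bar>\<sigma>\<^sup>2 / 2 * q y\<bar> \<le> \<sigma>\<^sup>2 / 2 * K" using K(3)[of y] unfolding abs_mult by (intro mult_mono) auto
      ultimately show ?thesis by linarith
    qed
    then show "AE \<omega> in M. norm (o' m n \<omega>) \<le> (C m * K + \<sigma>\<^sup>2 / 2 * K) * T m"
      unfolding o'_def real_norm_def using T C(1) K0 by (intro AE_I2 occupation_bounded) auto
  qed simp
  \<comment> \<open>survival time plus the excess of \<open>v\<close> at the stopping point over \<open>v l\<close>\<close>
  define q' where "q' m n \<omega> = S m n \<omega> + max 0 (v x\<^sub>0 - v l + g m n \<omega>)" for m n \<omega>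
  have q'm[measurable]: "q' m n \<in> borel_measurable M" for m n unfolding q'_def by measurable
  have q'_b: "0 \<le> q' m n \<omega>" "q' m n \<omega> \<le> S m n \<omega> + 4 * K" for m n \<omega>
    using S_b(1)[of m n \<omega>] g_b[of m n \<omega>] K(1)[of x\<^sub>0] K(1)[of l] K0
    by (auto simp: q'_def)
  have q'_i: "integrable M (q' m n)" for m n
  proof (rule integrable_const_bound[where B = "T m + 4 * K"])
    have "q' m n \<omega> \<le> T m + 4 * K" for \<omega>
      using q'_b(2)[of m n \<omega>] S_b(2)[of m n \<omega>] by linarith
    then show "AE \<omega> in M. norm (q' m n \<omega>) \<le> T m + 4 * K" using q'_b(1) by auto
  qed simp
  define Q where "Q m \<omega> = limsup (\<lambda>n. ennreal (q' m n \<omega>))" for m \<omega>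
  have [measurable]: "Q m \<in> borel_measurable M" for m unfolding Q_def by measurable
  have Q_int: "ennreal (v x\<^sub>0 - v l) \<le> (\<integral>\<^sup>+ \<omega>. Q m \<omega> \<partial>M)" for m
  proof -
    define e where "e n = expectation (\<lambda>\<omega>. g m n \<omega> - o' m n \<omega>)" for n
    have e: "e \<longlonglongrightarrow> 0" unfolding e_def g_def o'_def by (rule grid_dynkin[OF v T(1) C])
    have le: "v x\<^sub>0 - v l + e n \<le> expectation (q' m n)" for n
    proof -
      have "v x\<^sub>0 - v l + e n = expectation (\<lambda>\<omega>. v x\<^sub>0 - v l + (g m n \<omega> - o' m n \<omega>))"
        unfolding e_def using g_i o_i by (simp add: prob_space)
      also have "\<dots> \<le> expectation (q' m n)"
      proof (rule integral_mono)
        show "v x\<^sub>0 - v l + (g m n \<omega> - o' m n \<omega>) \<le> q' m n \<omega>" for \<omega>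
          using oS[of m n \<omega>] by (simp add: q'_def)
      qed (use g_i o_i q'_i in auto)
      finally show ?thesis .
    qed
    have "ennreal (v x\<^sub>0 - v l + 0) = limsup (\<lambda>n. ennreal (v x\<^sub>0 - v l + e n))"
      by (intro lim_imp_Limsup[symmetric] tendsto_ennrealI tendsto_intros e) simp
    also have "\<dots> \<le> limsup (\<lambda>n. \<integral>\<^sup>+ \<omega>. ennreal (q' m n \<omega>) \<partial>M)"
      using le by (intro Limsup_mono always_eventually allI)
        (simp add: nn_integral_eq_integral[OF q'_i] q'_b ennreal_leI)
    also have "\<dots> \<le> (\<integral>\<^sup>+ \<omega>. Q m \<omega> \<partial>M)"
      unfolding Q_def
    proof (rule nn_integral_limsup[where w = "\<lambda>_. ennreal (T m + 4 * K)"])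
      have "q' m n \<omega> \<le> T m + 4 * K" for n \<omega>
        using q'_b(2)[of m n \<omega>] S_b(2)[of m n \<omega>] by linarith
      then show "AE \<omega> in M. ennreal (q' m n \<omega>) \<le> ennreal (T m + 4 * K)" for n
        by (intro AE_I2 ennreal_leI)
      show "(\<integral>\<^sup>+ \<omega>. ennreal (T m + 4 * K) \<partial>M) < \<infinity>"
        by (simp add: emeasure_space_1 ennreal_mult_less_top)
    qed measurable
    finally show ?thesis by simp
  qed
  \<comment> \<open>any time at which the path is at or below \<open>l'\<close> bounds the approximations from above\<close>
  have Q_le: "Q m \<omega> \<le> ennreal s + ennreal (4 * K)"
    and Q_ev: "\<forall>\<^sub>F m in sequentially. Q m \<omega> \<le> ennreal s"
    if \<omega>: "regular \<omega>" and s: "0 \<le> s" "X s \<omega> \<le> l'" for m \<omega> s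
  proof -
    have sl: "X s \<omega> < l" using s l by simp
    have S_ev: "\<forall>\<^sub>F n in sequentially. S m n \<omega> \<le> s" for m
      unfolding S_def by (rule survival_eventually_le[OF \<omega> l(2) s(1) sl T(1)])
    have "\<forall>\<^sub>F n in sequentially. ennreal (q' m n \<omega>) \<le> ennreal s + ennreal (4 * K)"
      using S_ev[of m]
    proof eventually_elim
      case (elim n)
      then have "q' m n \<omega> \<le> s + 4 * K" using q'_b(2)[of m n \<omega>] by linarith
      then show ?case using s K0 by (simp add: ennreal_leI flip: ennreal_plus)
    qed
    then show "Q m \<omega> \<le> ennreal s + ennreal (4 * K)" unfolding Q_def by (rule Limsup_bounded)
    have "\<forall>\<^sub>F m in sequentially. s \<le> real m"
      by (rule filterlim_at_top[THEN iffD1, rule_format, OF filterlim_real_sequentially])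
    then show "\<forall>\<^sub>F m in sequentially. Q m \<omega> \<le> ennreal s"
      using path_below[OF \<omega>, of s]
    proof eventually_elim
      case (elim m)
      have "\<forall>\<^sub>F n in sequentially. g m n \<omega> \<le> v l - v x\<^sub>0"
        unfolding g_def using elim
        by (intro gain_eventually_le[OF \<omega> l(2) s(1) sl T(1) _ C(2) _ \<open>mono v\<close>]) (auto simp: T_def)
      then have "\<forall>\<^sub>F n in sequentially. ennreal (q' m n \<omega>) \<le> ennreal s"
        using S_ev[of m]
        by eventually_elim (intro ennreal_leI, simp add: q'_def)
      then show ?case unfolding Q_def by (rule Limsup_bounded)
    qed
  qed
  have "ennreal (v x\<^sub>0 - v l) \<le> limsup (\<lambda>m. \<integral>\<^sup>+ \<omega>. Q m \<omega> \<partial>M)"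
    using Q_int by (intro le_Limsup always_eventually allI) auto
  also have "\<dots> \<le> (\<integral>\<^sup>+ \<omega>. limsup (\<lambda>m. Q m \<omega>) \<partial>M)"
  proof (rule nn_integral_limsup[where w = "\<lambda>\<omega>. Y \<omega> + ennreal (4 * K)"])
    show "AE \<omega> in M. Q m \<omega> \<le> Y \<omega> + ennreal (4 * K)" for m
      using AE_regular Y(2)
    proof eventually_elim
      case (elim \<omega>)
      have "Q m \<omega> - ennreal (4 * K) \<le> hitting_time X l' \<omega>"
        unfolding hitting_time_def using Q_le[OF elim(1)]
        by (intro INF_greatest) (auto simp: ennreal_minus_le_iff add.commute)
      also have "\<dots> \<le> Y \<omega>" by (rule elim(2))
      finally show ?case by (simp add: ennreal_minus_le_iff add.commute)
    qed
    show "(\<integral>\<^sup>+ \<omega>. Y \<omega> + ennreal (4 * K) \<partial>M) < \<infinity>"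
      using Y(3) by (subst nn_integral_add) (auto simp: emeasure_space_1)
  qed measurable
  also have "\<dots> \<le> (\<integral>\<^sup>+ \<omega>. hitting_time X l' \<omega> \<partial>M)"
  proof (rule nn_integral_mono_AE)
    show "AE \<omega> in M. limsup (\<lambda>m. Q m \<omega>) \<le> hitting_time X l' \<omega>"
      using AE_regular
    proof eventually_elim
      case (elim \<omega>)
      show ?case unfolding hitting_time_def
        using Q_ev[OF elim] by (intro INF_greatest Limsup_bounded) auto
    qed
  qed
  finally show ?thesis .
qed

end

section \<open>Construction of the test functions\<close>

text \<open>Comparing antiderivatives by their derivatives replaces all estimates of integrals below.\<close>

lemma increment_mono:
  fixes f g :: "real \<Rightarrow> real"
  assumes "a \<le> b" "\<And>y. y \<in> {a..b} \<Longrightarrow> (f has_real_derivative f' y) (at y)"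
    "\<And>y. y \<in> {a..b} \<Longrightarrow> (g has_real_derivative g' y) (at y)" "\<And>y. y \<in> {a..b} \<Longrightarrow> f' y \<le> g' y"
  shows "f b - f a \<le> g b - g a"
proof -
  have "g a - f a \<le> g b - f b"
  proof (rule DERIV_nonneg_imp_nondecreasing[OF assms(1), of "\<lambda>y. g y - f y"])
    fix y assume "a \<le> y" "y \<le> b"
    then show "\<exists>D. ((\<lambda>y. g y - f y) has_real_derivative D) (at y) \<and> 0 \<le> D"
      using assms(2-4)[of y] by (intro exI[of _ "g' y - f' y"] conjI DERIV_diff) auto
  qed
  then show ?thesis by simp
qed

lemma increment_zero:
  fixes f :: "real \<Rightarrow> real"
  assumes "a \<le> b" "\<And>y. (f has_real_derivative f' y) (at y)" "\<And>y. y \<in> {a..b} \<Longrightarrow> f' y = 0"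
  shows "f a = f b"
proof -
  have "f b - f a \<le> 0 - 0"
    by (rule increment_mono[OF assms(1) assms(2) DERIV_const]) (simp add: assms(3))
  moreover have "0 - 0 \<le> f b - f a"
    by (rule increment_mono[OF assms(1) DERIV_const assms(2)]) (simp add: assms(3))
  ultimately show ?thesis by simp
qed

lemma nondecreasing_if_derivative_nonneg:
  fixes f :: "real \<Rightarrow> real"
  assumes "a \<le> b" "\<And>y. (f has_real_derivative f' y) (at y)" "\<And>y. 0 \<le> f' y"
  shows "f a \<le> f b"
proof -
  have "0 - 0 \<le> f b - f a"
    by (rule increment_mono[OF assms(1) DERIV_const assms(2)]) (simp add: assms(3))
  then show ?thesis by simp
qed

lemma continuous_on_if_derivative:
  fixes f :: "real \<Rightarrow> real"
  assumes "\<And>y. (f has_real_derivative f' y) (at y)"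
  shows "continuous_on S f"
  by (rule DERIV_continuous_on) (rule has_field_derivative_at_within[OF assms])

lemma antiderivative_exists:
  fixes f :: "real \<Rightarrow> real"
  assumes "continuous_on UNIV f"
  obtains I where "\<And>y. (I has_real_derivative f y) (at y)"
proof -
  have "isCont f x" for x using assms by (simp add: continuous_on_eq_continuous_at)
  then obtain I where "\<forall>x::real. - \<infinity> < ereal x \<longrightarrow> ereal x < \<infinity> \<longrightarrow> (I has_vector_derivative f x) (at x)"
    using einterval_antiderivative[of "- \<infinity>" "\<infinity>" f] by auto
  then show thesis using that[of I] by (simp add: has_real_derivative_iff_has_vector_derivative)
qed

text \<open>All values are attained on \<open>[a, b]\<close>, and the projection onto \<open>[a, b]\<close> does not increase distances.\<close>

lemma constant_ends_uniformly_continuous: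
  fixes h :: "real \<Rightarrow> real"
  assumes "continuous_on UNIV h" "a \<le> b" "\<And>y. y \<le> a \<Longrightarrow> h y = h a" "\<And>y. b \<le> y \<Longrightarrow> h y = h b"
  shows "bounded (range h)" "uniformly_continuous_on UNIV h"
proof -
  define k where "k y = max a (min b y)" for y
  have k: "k y \<in> {a..b}" "h y = h (k y)" for y
    using assms(2) assms(3,4)[of y] by (auto simp: k_def max_def min_def)
  have c: "continuous_on {a..b} h" using assms(1) continuous_on_subset by blast
  have "range h \<subseteq> h ` {a..b}" using k by blast
  then show "bounded (range h)"
    using compact_imp_bounded[OF compact_continuous_image[OF c compact_Icc]] bounded_subset by blast
  have u: "uniformly_continuous_on {a..b} h" by (rule compact_uniformly_continuous[OF c compact_Icc])
  show "uniformly_continuous_on UNIV h"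
    unfolding uniformly_continuous_on_def
  proof (intro allI impI)
    fix e :: real assume "e > 0"
    then obtain d where d: "d > 0" "\<And>x y. x \<in> {a..b} \<Longrightarrow> y \<in> {a..b} \<Longrightarrow> dist y x < d \<Longrightarrow> dist (h y) (h x) < e"
      using u unfolding uniformly_continuous_on_def by metis
    have "dist (k y) (k x) \<le> dist y x" for x y by (auto simp: k_def dist_real_def)
    then show "\<exists>d>0. \<forall>x\<in>UNIV. \<forall>y\<in>UNIV. dist y x < d \<longrightarrow> dist (h y) (h x) < e"
      using d k by (intro exI[of _ d]) (metis le_less_trans)
  qed
qed

lemma smooth_cutoff:
  fixes l d :: real
  assumes "d > 0"
  shows "\<exists>\<kappa> \<kappa>'. (\<forall>y. (\<kappa> has_real_derivative \<kappa>' y) (at y)) \<and> continuous_on UNIV \<kappa>' \<and>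
    (\<forall>y. 0 \<le> \<kappa> y \<and> \<kappa> y \<le> 1) \<and> (\<forall>y\<le>l - d. \<kappa> y = 0 \<and> \<kappa>' y = 0) \<and> (\<forall>y\<ge>l. \<kappa> y = 1 \<and> \<kappa>' y = 0)"
proof -
  \<comment> \<open>the derivative of the cutoff, up to normalization, is a tent over \<open>[l - d, l]\<close>\<close>
  define t where "t y = max 0 (min (y - (l - d)) (l - y))" for y
  have ct: "continuous_on UNIV t" unfolding t_def by (intro continuous_intros)
  obtain I where I: "\<And>y. (I has_real_derivative t y) (at y)" using antiderivative_exists[OF ct] by blast
  have t0: "t y = 0" if "y \<le> l - d \<or> l \<le> y" for y using that by (auto simp: t_def)
  have mono: "I x \<le> I y" if "x \<le> y" for x y
    using nondecreasing_if_derivative_nonneg[OF that I] by (simp add: t_def)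
  have const: "I x = I y" if "x \<le> y" "y \<le> l - d \<or> l \<le> x" for x y
    using that t0 by (intro increment_zero[OF that(1) I]) auto
  define D where "D = I l - I (l - d)"
  have t_pos: "\<exists>D. (I has_real_derivative D) (at x) \<and> 0 < D" if "l - d < x" "x < l" for x
    using that by (intro exI[of _ "t x"] conjI I) (simp add: t_def)
  have "I (l - d) < I l"
    by (rule DERIV_pos_imp_increasing_open[OF _ t_pos continuous_on_if_derivative[OF I]]) (use assms in auto)
  then have D: "D > 0" by (simp add: D_def)
  have lo: "I y = I (l - d)" if "y \<le> l - d" for y using const[of y "l - d"] that by simp
  have hi: "I y = I l" if "l \<le> y" for y using const[of l y] that by simp
  have range: "I (l - d) \<le> I y" "I y \<le> I l" for y
    using mono[of "l - d" y] mono[of y l] lo[of y] hi[of y] assms by linarith+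
  define k k' where "k y = (I y - I (l - d)) / D" and "k' y = t y / D" for y
  have "(k has_real_derivative k' y) (at y)" for y
    unfolding k_def[abs_def] k'_def by (rule DERIV_cong[OF DERIV_cdivide[OF DERIV_diff[OF I DERIV_const]]]) simp
  moreover have "continuous_on UNIV k'"
    unfolding k'_def[abs_def] using D by (intro continuous_on_divide ct continuous_on_const) auto
  moreover have "0 \<le> k y \<and> k y \<le> 1" for y
    using D range[of y] by (simp add: D_def k_def)
  moreover have "k y = 0 \<and> k' y = 0" if "y \<le> l - d" for y
    using lo[OF that] t0 that by (simp add: k_def k'_def)
  moreover have "k y = 1 \<and> k' y = 0" if "l \<le> y" for y
    using hi[OF that] t0 that D by (simp add: D_def k_def k'_def)
  ultimately show ?thesis by blast
qed

text \<open>Equal to \<open>1\<close> up to \<open>R\<close> and to \<open>0\<close> from \<open>R + 1\<close> on: a continuous replacement of the right-hand side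
  \<open>1\<close> for which the solution has vanishing derivative beyond \<open>R + 1\<close>, hence is bounded.\<close>

definition source :: "real \<Rightarrow> real \<Rightarrow> real" where
  "source R y = max 0 (min 1 (R + 1 - y))"

text \<open>Variation of constants solves \<open>\<epsilon> p' - F' p = - \<phi>\<close> by
  \<open>p y = exp (F y / \<epsilon>) / \<epsilon> \<integral> \<phi> z exp (- F z / \<epsilon>) dz\<close>, the integral ranging over \<open>z > y\<close>; here \<open>I\<close> is
  an antiderivative of the integrand for \<open>\<phi> = source R\<close>. A cutoff \<open>\<kappa>\<close> on \<open>[l - d, l]\<close> makes \<open>p\<close> vanish
  on the left as well, without affecting the equation on the right of \<open>l\<close>.\<close>

lemma test_function_exists:
  fixes F F' :: "real \<Rightarrow> real"
  assumes F: "\<And>y. (F has_real_derivative F' y) (at y)" and F': "continuous_on UNIV F'"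
    and "\<epsilon> > 0" "d > 0" "l \<le> R"
  obtains I v p q where "smooth_test v p q"
    "\<And>y. (I has_real_derivative source R y * exp (- F y / \<epsilon>)) (at y)"
    "\<And>y. p y \<le> exp (F y / \<epsilon>) * (I (R + 1) - I y) / \<epsilon>"
    "\<And>y. l \<le> y \<Longrightarrow> p y = exp (F y / \<epsilon>) * (I (R + 1) - I y) / \<epsilon>"
    "\<And>y. y \<le> l - d \<Longrightarrow> p y = 0"
    "\<And>y. l \<le> y \<Longrightarrow> - F' y * p y + \<epsilon> * q y = - source R y"
proof -
  have cF: "continuous_on UNIV F" by (rule continuous_on_if_derivative[OF F])
  have cs: "continuous_on UNIV (source R)" unfolding source_def by (intro continuous_intros)
  have "continuous_on UNIV (\<lambda>y. source R y * exp (- F y / \<epsilon>))"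
    using assms(3) by (intro continuous_intros cs cF) auto
  then obtain I where I: "\<And>y. (I has_real_derivative source R y * exp (- F y / \<epsilon>)) (at y)"
    using antiderivative_exists by blast
  have cI: "continuous_on UNIV I" by (rule continuous_on_if_derivative[OF I])
  have I_mono: "I x \<le> I y" if "x \<le> y" for x y
    by (rule nondecreasing_if_derivative_nonneg[OF that I]) (simp add: source_def)
  have I_const: "I y = I (R + 1)" if "R + 1 \<le> y" for y
    by (rule increment_zero[OF that I, symmetric]) (simp add: source_def)
  have I_le: "I y \<le> I (R + 1)" for y using I_mono[of y "R + 1"] I_const[of y] by linarith
  obtain \<kappa> \<kappa>' where "\<forall>y. (\<kappa> has_real_derivative \<kappa>' y) (at y)" "continuous_on UNIV \<kappa>'"
    "\<forall>y. 0 \<le> \<kappa> y \<and> \<kappa> y \<le> 1" "\<forall>y\<le>l - d. \<kappa> y = 0 \<and> \<kappa>' y = 0" "\<forall>y\<ge>l. \<kappa> y = 1 \<and> \<kappa>' y = 0"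
    using smooth_cutoff[OF assms(4), of l] by (elim exE conjE)
  then have \<kappa>: "\<And>y. (\<kappa> has_real_derivative \<kappa>' y) (at y)" "continuous_on UNIV \<kappa>'"
    "\<And>y. 0 \<le> \<kappa> y" "\<And>y. \<kappa> y \<le> 1" "\<And>y. y \<le> l - d \<Longrightarrow> \<kappa> y = 0" "\<And>y. l \<le> y \<Longrightarrow> \<kappa> y = 1"
    "\<And>y. y \<le> l - d \<Longrightarrow> \<kappa>' y = 0" "\<And>y. l \<le> y \<Longrightarrow> \<kappa>' y = 0"
    by blast+
  have c\<kappa>: "continuous_on UNIV \<kappa>" by (rule continuous_on_if_derivative[OF \<kappa>(1)])
  define P where "P y = exp (F y / \<epsilon>) * (I (R + 1) - I y) / \<epsilon>" for y
  define P' where "P' y = (F' y * P y - source R y) / \<epsilon>" for y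
  have P: "(P has_real_derivative P' y) (at y)" for y
  proof -
    have e: "source R y * exp (- F y / \<epsilon>) * exp (F y / \<epsilon>) = source R y"
      by (simp add: mult.assoc flip: exp_add)
    have E: "((\<lambda>y. exp (F y / \<epsilon>)) has_real_derivative exp (F y / \<epsilon>) * (F' y / \<epsilon>)) (at y)"
      by (rule DERIV_fun_exp[OF DERIV_cdivide[OF F]])
    have "((\<lambda>y. I (R + 1) - I y) has_real_derivative - (source R y * exp (- F y / \<epsilon>))) (at y)"
      using DERIV_diff[OF DERIV_const I] by simp
    from DERIV_cdivide[OF DERIV_mult[OF E this], of \<epsilon>]
    have "(P has_real_derivative (exp (F y / \<epsilon>) * (F' y / \<epsilon>) * (I (R + 1) - I y)
      + - (source R y * exp (- F y / \<epsilon>)) * exp (F y / \<epsilon>)) / \<epsilon>) (at y)"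
      unfolding P_def[abs_def] .
    also have "exp (F y / \<epsilon>) * (F' y / \<epsilon>) * (I (R + 1) - I y)
      + - (source R y * exp (- F y / \<epsilon>)) * exp (F y / \<epsilon>) = F' y * P y - source R y"
      unfolding mult_minus_left e by (simp add: P_def)
    finally show ?thesis by (simp add: P'_def)
  qed
  have cP: "continuous_on UNIV P" by (rule continuous_on_if_derivative[OF P])
  have cP': "continuous_on UNIV P'" unfolding P'_def using assms(3) by (intro continuous_intros F' cP cs) auto
  have P0: "0 \<le> P y" for y using I_le assms(3) by (simp add: P_def)
  have P_far: "P y = 0" "P' y = 0" if "R + 1 \<le> y" for y
    using I_const[OF that] that by (simp_all add: P_def P'_def source_def)
  define p where "p y = P y * \<kappa> y" for y
  define q where "q y = P' y * \<kappa> y + P y * \<kappa>' y" for y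
  have dp: "(p has_real_derivative q y) (at y)" for y
    unfolding p_def q_def using DERIV_mult[OF P \<kappa>(1), of y] by (simp add: algebra_simps)
  have cp: "continuous_on UNIV p" unfolding p_def by (intro continuous_intros cP c\<kappa>)
  have cq: "continuous_on UNIV q" unfolding q_def by (intro continuous_intros cP cP' c\<kappa> \<kappa>(2))
  obtain v where v: "\<And>y. (v has_real_derivative p y) (at y)" using antiderivative_exists[OF cp] by blast
  have cv: "continuous_on UNIV v" by (rule continuous_on_if_derivative[OF v])
  have p_nonneg: "0 \<le> p y" for y using P0 \<kappa>(3) by (simp add: p_def)
  have zero: "p y = 0" "q y = 0" if "y \<le> l - d \<or> R + 1 \<le> y" for y
    using that \<kappa>(5,7) P_far by (auto simp: p_def q_def)
  have v_const: "v x = v y" if "x \<le> y" "y \<le> l - d \<or> R + 1 \<le> x" for x y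
    using that zero(1) by (intro increment_zero[OF that(1) v]) auto
  have ab: "l - d \<le> R + 1" using assms(4,5) by simp
  have "bounded (range v)"
  proof (rule constant_ends_uniformly_continuous(1)[OF cv ab])
    show "v y = v (l - d)" if "y \<le> l - d" for y by (rule v_const) (use that in auto)
    show "v y = v (R + 1)" if "R + 1 \<le> y" for y by (rule v_const[symmetric]) (use that in auto)
  qed
  moreover have "bounded (range p)"
    by (rule constant_ends_uniformly_continuous(1)[OF cp ab]) (simp_all add: zero)
  moreover have "bounded (range q)"
    by (rule constant_ends_uniformly_continuous(1)[OF cq ab]) (simp_all add: zero)
  moreover have "uniformly_continuous_on UNIV q"
    by (rule constant_ends_uniformly_continuous(2)[OF cq ab]) (simp_all add: zero)
  ultimately have "smooth_test v p q"
    unfolding smooth_test_def using v dp p_nonneg by blast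
  moreover have "p y \<le> exp (F y / \<epsilon>) * (I (R + 1) - I y) / \<epsilon>" for y
    using mult_left_mono[OF \<kappa>(4) P0, of y y] by (simp add: p_def flip: P_def)
  moreover have "p y = exp (F y / \<epsilon>) * (I (R + 1) - I y) / \<epsilon>" if "l \<le> y" for y
    using \<kappa>(6)[OF that] by (simp add: p_def flip: P_def)
  moreover have "p y = 0" if "y \<le> l - d" for y using zero(1) that by blast
  moreover have "- F' y * p y + \<epsilon> * q y = - source R y" if "l \<le> y" for y
    using \<kappa>(6,8)[OF that] assms(3) by (simp add: p_def q_def P'_def)
  ultimately show thesis by (rule that[OF _ I])
qed

section \<open>Laplace estimates of the test functions\<close>

text \<open>Integrating the majorant \<open>A / (1 + z\<^sup>2)\<close> over the line gives the factor \<open>pi\<close>, independently of the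
  cutoff at \<open>b\<close>.\<close>

lemma test_function_increment_le:
  fixes F :: "real \<Rightarrow> real"
  assumes "\<epsilon> > 0" "\<alpha> \<le> x" "x \<le> b" "A \<ge> 0"
    and I: "\<And>y. (I has_real_derivative \<phi> y * exp (- F y / \<epsilon>)) (at y)" and \<phi>: "\<And>y. \<phi> y \<le> 1"
    and v: "\<And>y. (v has_real_derivative p y) (at y)"
    and p: "\<And>y. p y \<le> exp (F y / \<epsilon>) * (I b - I y) / \<epsilon>"
    and A: "\<And>y z. \<alpha> \<le> y \<Longrightarrow> y \<le> x \<Longrightarrow> y \<le> z \<Longrightarrow> exp ((F y - F z) / \<epsilon>) \<le> A / (1 + z\<^sup>2)"
  shows "v x - v \<alpha> \<le> (x - \<alpha>) * (A * pi / \<epsilon>)"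
proof -
  have "p y \<le> A * pi / \<epsilon>" if y: "\<alpha> \<le> y" "y \<le> x" for y
  proof -
    have "exp (F y / \<epsilon>) * I b - exp (F y / \<epsilon>) * I y \<le> A * arctan b - A * arctan y"
    proof (rule increment_mono[OF _ DERIV_cmult[OF I] DERIV_cmult[OF DERIV_arctan]])
      fix z assume "z \<in> {y..b}"
      then have "exp ((F y - F z) / \<epsilon>) \<le> A / (1 + z\<^sup>2)" using A y by simp
      moreover have "exp (F y / \<epsilon>) * (\<phi> z * exp (- F z / \<epsilon>)) = \<phi> z * exp ((F y - F z) / \<epsilon>)"
        by (simp add: diff_divide_distrib exp_diff exp_minus field_simps)
      moreover have "\<phi> z * exp ((F y - F z) / \<epsilon>) \<le> 1 * exp ((F y - F z) / \<epsilon>)"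
        using \<phi> by (intro mult_right_mono) auto
      ultimately have "exp (F y / \<epsilon>) * (\<phi> z * exp (- F z / \<epsilon>)) \<le> A / (1 + z\<^sup>2)" by linarith
      then show "exp (F y / \<epsilon>) * (\<phi> z * exp (- F z / \<epsilon>)) \<le> A * inverse (1 + z\<^sup>2)"
        by (simp only: divide_inverse)
    qed (use y assms(3) in linarith)
    also have "\<dots> = A * (arctan b - arctan y)" by (simp add: algebra_simps)
    also have "\<dots> \<le> A * pi"
      using arctan_ubound[of b] arctan_lbound[of y] assms(4) by (intro mult_left_mono) auto
    finally have "exp (F y / \<epsilon>) * (I b - I y) \<le> A * pi" by (simp add: algebra_simps)
    then show ?thesis using p[of y] assms(1) divide_right_mono[of _ "A * pi" \<epsilon>] by (meson less_imp_le order_trans)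
  qed
  then have "v x - v \<alpha> \<le> A * pi / \<epsilon> * x - A * pi / \<epsilon> * \<alpha>"
    by (intro increment_mono[OF assms(2) v DERIV_cmult_Id]) auto
  also have "\<dots> = (x - \<alpha>) * (A * pi / \<epsilon>)"
    by (metis mult.commute right_diff_distrib)
  finally show ?thesis .
qed

text \<open>Only the square of pairs \<open>(y, z)\<close> with \<open>y\<close> near \<open>s\<close> and \<open>z\<close> near \<open>x\<close> is kept of the double
  integral; its area is \<open>r\<^sup>2\<close>.\<close>

lemma test_function_increment_ge:
  fixes F :: "real \<Rightarrow> real"
  assumes "\<epsilon> > 0" "l \<le> s" "r > 0" "s + r \<le> x - r" "x \<le> b"
    and I: "\<And>y. (I has_real_derivative \<phi> y * exp (- F y / \<epsilon>)) (at y)"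
    and \<phi>: "\<And>y. 0 \<le> \<phi> y" "\<And>y. y \<le> x \<Longrightarrow> \<phi> y = 1"
    and v: "\<And>y. (v has_real_derivative p y) (at y)"
    and p: "\<And>y. l \<le> y \<Longrightarrow> p y = exp (F y / \<epsilon>) * (I b - I y) / \<epsilon>" "\<And>y. 0 \<le> p y"
    and m: "\<And>y z. y \<in> {s..s + r} \<Longrightarrow> z \<in> {x - r..x} \<Longrightarrow> m \<le> F y - F z"
  shows "r\<^sup>2 * exp (m / \<epsilon>) / \<epsilon> \<le> v x - v l"
proof -
  have I_mono: "I u \<le> I w" if "u \<le> w" for u w
    by (rule nondecreasing_if_derivative_nonneg[OF that I]) (simp add: \<phi>(1))
  have v_mono: "v u \<le> v w" if "u \<le> w" for u w
    by (rule nondecreasing_if_derivative_nonneg[OF that v p(2)])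
  have "r * exp (m / \<epsilon>) / \<epsilon> \<le> p y" if y: "y \<in> {s..s + r}" for y
  proof -
    have "exp (m / \<epsilon>) * x - exp (m / \<epsilon>) * (x - r) \<le> exp (F y / \<epsilon>) * I x - exp (F y / \<epsilon>) * I (x - r)"
    proof (rule increment_mono[OF _ DERIV_cmult_Id DERIV_cmult[OF I]])
      fix z assume z: "z \<in> {x - r..x}"
      then have "exp (m / \<epsilon>) \<le> exp ((F y - F z) / \<epsilon>)"
        using m[OF y z] assms(1) by (simp add: divide_right_mono)
      moreover have "exp (F y / \<epsilon>) * (\<phi> z * exp (- F z / \<epsilon>)) = exp ((F y - F z) / \<epsilon>)"
        using \<phi>(2)[of z] z by (simp add: diff_divide_distrib exp_diff exp_minus field_simps)
      ultimately show "exp (m / \<epsilon>) \<le> exp (F y / \<epsilon>) * (\<phi> z * exp (- F z / \<epsilon>))" by simp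
    qed (use assms(3) in linarith)
    then have "r * exp (m / \<epsilon>) \<le> exp (F y / \<epsilon>) * (I x - I (x - r))" by (simp add: algebra_simps)
    also have "\<dots> \<le> exp (F y / \<epsilon>) * (I b - I y)"
      using I_mono[of x b] I_mono[of y "x - r"] y assms(4,5) by (intro mult_left_mono) auto
    finally show ?thesis using p(1)[of y] y assms(1,2) by (simp add: divide_right_mono)
  qed
  then have "r * exp (m / \<epsilon>) / \<epsilon> * (s + r) - r * exp (m / \<epsilon>) / \<epsilon> * s \<le> v (s + r) - v s"
    using assms(3) by (intro increment_mono[OF _ DERIV_cmult_Id v]) auto
  also have "v (s + r) - v s \<le> v x - v l" using v_mono[of "s + r" x] v_mono[of l s] assms(2-4) by simp
  also have "r * exp (m / \<epsilon>) / \<epsilon> * (s + r) - r * exp (m / \<epsilon>) / \<epsilon> * s = r\<^sup>2 * exp (m / \<epsilon>) / \<epsilon>"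
    by (simp add: distrib_left power2_eq_square)
  finally show ?thesis .
qed

section \<open>The shape of a double well\<close>

text \<open>A local minimum that is also the maximum on one side of it is an end point of an interval on
  which \<open>h\<close> is constant, and all points inside such an interval are local minima. So an extremum over a
  compact interval is not attained at an end of it that is a well or the top of the barrier.\<close>

lemma flat_side_many_local_min:
  fixes h :: "real \<Rightarrow> real"
  assumes a: "local_min h a" and uw: "u < w" "a = u \<or> a = w" and le: "\<And>y. y \<in> {u..w} \<Longrightarrow> h y \<le> h a"
  shows "infinite {x. local_min h x}"
proof -
  obtain d where d: "d > 0" "\<And>y. dist y a < d \<Longrightarrow> h a \<le> h y"
    using a unfolding local_min_def eventually_nhds_metric by blast
  define J where "J = {u<..<w} \<inter> ball a d"
  have "open J" by (simp add: J_def open_Int)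
  have eq: "h y = h a" if "y \<in> J" for y
    using that d(2)[of y] le[of y] by (force simp: J_def dist_commute)
  have "J \<subseteq> {x. local_min h x}"
  proof
    fix y assume y: "y \<in> J"
    have "\<forall>\<^sub>F z in nhds y. z \<in> J" by (rule eventually_nhds_in_open[OF \<open>open J\<close> y])
    then show "y \<in> {x. local_min h x}"
      unfolding local_min_def using eq y by (auto elim: eventually_mono)
  qed
  moreover have "J \<noteq> {}"
  proof -
    define e where "e = min (w - u) d / 2"
    have "e > 0" "e < w - u" "e < d" using uw d by (auto simp: e_def)
    then have "u + e \<in> J \<or> w - e \<in> J" using uw(2) by (auto simp: J_def dist_real_def)
    then show ?thesis by blast
  qed
  then have "infinite J" using \<open>open J\<close> finite_imp_not_open by blast
  ultimately show ?thesis using infinite_super by blast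
qed

lemma local_extremum_interior:
  fixes h :: "real \<Rightarrow> real"
  assumes "m \<in> {a<..<b}"
  shows "(\<And>y. y \<in> {a..b} \<Longrightarrow> h y \<le> h m) \<Longrightarrow> local_max h m"
    and "(\<And>y. y \<in> {a..b} \<Longrightarrow> h m \<le> h y) \<Longrightarrow> local_min h m"
proof -
  have ev: "\<forall>\<^sub>F y in nhds m. y \<in> {a<..<b}" using assms by (intro eventually_nhds_in_open) auto
  show "local_max h m" if "\<And>y. y \<in> {a..b} \<Longrightarrow> h y \<le> h m"
    unfolding local_max_def using ev by (rule eventually_mono) (use that in auto)
  show "local_min h m" if "\<And>y. y \<in> {a..b} \<Longrightarrow> h m \<le> h y"
    unfolding local_min_def using ev by (rule eventually_mono) (use that in auto)
qed

text \<open>Each claim compares with an extremum over a compact interval. It cannot lie in the interior,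
  because it would be a further local extremum, nor at the wrong end, because of
  \<open>flat_side_many_local_min\<close>. In the last claim the interval is closed on the right by a point at which
  \<open>h\<close> exceeds \<open>h xp\<close>.\<close>

lemma double_well_shape:
  assumes c: "continuous_on UNIV h" and dw: "double_well h xm xs xp"
  shows "\<And>y z. xm \<le> y \<Longrightarrow> y \<le> z \<Longrightarrow> z \<le> xs \<Longrightarrow> h y \<le> h z"
    and "\<And>y. xs \<le> y \<Longrightarrow> y \<le> xp \<Longrightarrow> h y \<le> h xs"
    and "\<And>z. filterlim h at_top at_top \<Longrightarrow> xs \<le> z \<Longrightarrow> h xp \<le> h z"
proof -
  have ord: "xm < xs" "xs < xp" and mins: "{x. local_min h x} = {xm, xp}" and maxs: "{x. local_max h x} = {xs}"
    using dw by (auto simp: double_well_def)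
  have fin: "finite {x. local_min h x}" using mins by simp
  have lmin: "local_min h xm" "local_min h xp" and lmax: "local_max h xs" using mins maxs by auto
  have cS: "continuous_on S h" for S using c continuous_on_subset by blast
  show "h y \<le> h z" if yz: "xm \<le> y" "y \<le> z" "z \<le> xs" for y z
  proof (cases "xm < z")
    case True
    obtain m where m: "m \<in> {xm..z}" "\<And>y. y \<in> {xm..z} \<Longrightarrow> h y \<le> h m"
      using continuous_attains_sup[of "{xm..z}" h] cS True by auto
    have "m \<noteq> xm"
      using flat_side_many_local_min[OF lmin(1) True, of] m(2) fin by blast
    moreover have "m \<notin> {xm<..<z}"
    proof
      assume i: "m \<in> {xm<..<z}"
      have "local_max h m" using i m(2) by (rule local_extremum_interior(1))
      then have "m = xs" using maxs by blast
      then show False using i yz(3) by simp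
    qed
    ultimately have "m = z" using m(1) by auto
    then show ?thesis using m(2)[of y] yz by simp
  next
    case False
    then have "y = z" using yz by simp
    then show ?thesis by simp
  qed
  show "h y \<le> h xs" if y: "xs \<le> y" "y \<le> xp" for y
  proof -
    obtain m where m: "m \<in> {xs..xp}" "\<And>y. y \<in> {xs..xp} \<Longrightarrow> h y \<le> h m"
      using continuous_attains_sup[of "{xs..xp}" h] cS ord by auto
    have "m \<noteq> xp"
      using flat_side_many_local_min[OF lmin(2) ord(2)] m(2) fin by blast
    moreover have "m \<notin> {xs<..<xp}"
    proof
      assume i: "m \<in> {xs<..<xp}"
      have "local_max h m" using i m(2) by (rule local_extremum_interior(1))
      then have "m = xs" using maxs by blast
      then show False using i by simp
    qed
    ultimately have "m = xs" using m(1) by auto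
    then show ?thesis using m(2)[of y] y by simp
  qed
  show "h xp \<le> h z" if lim: "filterlim h at_top at_top" and z: "xs \<le> z" for z
  proof -
    have "\<forall>\<^sub>F x in at_top. h xp < h x" using lim by (simp add: filterlim_at_top_dense)
    then have "\<forall>\<^sub>F x in at_top. h xp < h x \<and> max z xp < x"
      using eventually_gt_at_top by (rule eventually_conj)
    then obtain R where R: "h xp < h R" "z < R" "xp < R"
      by (auto simp: eventually_at_top_linorder)
    have xsR: "xs < R" using R ord by simp
    obtain m where m: "m \<in> {xs..R}" "\<And>y. y \<in> {xs..R} \<Longrightarrow> h m \<le> h y"
      using continuous_attains_inf[of "{xs..R}" h] cS xsR by auto
    have "m \<noteq> R" using m(2)[of xp] R ord by auto
    moreover have "m \<noteq> xs"
    proof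
      assume "m = xs"
      moreover have "local_min (\<lambda>x. - h x) xs" using lmax by (simp add: local_min_def local_max_def)
      ultimately have "infinite {x. local_min (\<lambda>x. - h x) x}"
        using flat_side_many_local_min[of "\<lambda>x. - h x" xs xs R] xsR m(2) by simp
      then show False using maxs by (simp add: local_min_def local_max_def)
    qed
    ultimately have "m \<in> {xs<..<R}" using m(1) by auto
    then have "local_min h m" using m(2) by (rule local_extremum_interior(2))
    then have "m \<in> {xm, xp}" using mins by blast
    then have "m = xp" using \<open>m \<in> {xs<..<R}\<close> ord by auto
    then show ?thesis using m(2)[of z] z R by simp
  qed
qed

text \<open>Going to the left, \<open>h\<close> cannot climb by more than \<open>2 * \<eta>\<close> unless the climb starts to the right of
  \<open>xs\<close>, where \<open>h xp\<close> is the minimum. The margin \<open>\<delta>\<close> to the left of \<open>xm\<close> is where the test functions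
  are cut off.\<close>

lemma double_well_barrier:
  assumes c: "continuous_on UNIV h" and dw: "double_well h xm xs xp" and lim: "filterlim h at_top at_top" and "\<eta> > 0"
  obtains \<delta> where "\<delta> > 0" "\<And>y. xm - \<delta> \<le> y \<Longrightarrow> y \<le> xp \<Longrightarrow> h y \<le> h xs + \<eta>"
    "\<And>y z. xm - \<delta> \<le> y \<Longrightarrow> y \<le> xp \<Longrightarrow> y \<le> z \<Longrightarrow> h y - h z \<le> h xs - h xp + 2 * \<eta>"
proof -
  note shape = double_well_shape[OF c dw]
  have ord: "xm < xs" "xs < xp" using dw by (auto simp: double_well_def)
  have "isCont h xm" using c by (simp add: continuous_on_eq_continuous_at)
  then obtain d where d: "d > 0" "\<And>y. dist y xm < d \<Longrightarrow> dist (h y) (h xm) < \<eta>"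
    using \<open>\<eta> > 0\<close> unfolding continuous_at_eps_delta by blast
  have near: "\<bar>h y - h xm\<bar> < \<eta>" if "xm - d / 2 \<le> y" "y \<le> xm" for y
    using d(2)[of y] that d(1) by (simp add: dist_real_def)
  have xmxs: "h xm \<le> h xs" using shape(1)[of xm xs] ord by simp
  have D: "h xp \<le> h xs" using shape(2)[of xp] ord by simp
  have far: "h xp \<le> h z" if "xs \<le> z" for z using shape(3)[OF lim that] .
  have up: "h y \<le> h xs + \<eta>" if y: "xm - d / 2 \<le> y" "y \<le> xp" for y
  proof -
    consider "y \<le> xm" | "xm \<le> y" "y \<le> xs" | "xs \<le> y" by linarith
    then show ?thesis
    proof cases
      case 1
      then show ?thesis using near[of y] y xmxs by linarith
    next
      case 2
      then show ?thesis using shape(1)[of y xs] \<open>\<eta> > 0\<close> by simp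
    next
      case 3
      then show ?thesis using shape(2)[of y] y \<open>\<eta> > 0\<close> by simp
    qed
  qed
  have "h y - h z \<le> h xs - h xp + 2 * \<eta>" if y: "xm - d / 2 \<le> y" "y \<le> xp" "y \<le> z" for y z
  proof -
    consider "xs \<le> z" | "z < xs" "y \<le> xm" "z \<le> xm" | "z < xs" "y \<le> xm" "xm \<le> z" | "z < xs" "xm \<le> y" by linarith
    then show ?thesis
    proof cases
      case 1
      then show ?thesis using up[of y] far[of z] y \<open>\<eta> > 0\<close> by linarith
    next
      case 2
      then show ?thesis using near[of y] near[of z] y D by linarith
    next
      case 3
      then show ?thesis using near[of y] shape(1)[of xm z] y D \<open>\<eta> > 0\<close> by linarith
    next
      case 4
      then show ?thesis using shape(1)[of y z] y D \<open>\<eta> > 0\<close> by linarith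
    qed
  qed
  then show thesis using that[of "d / 2"] d(1) up by simp
qed

section \<open>Kramers' law\<close>

lemma C1_on_continuous:
  assumes "C1_on S f"
  shows "continuous_on S f"
proof -
  obtain f' where f': "\<And>z. z \<in> S \<Longrightarrow> (f has_derivative blinfun_apply (f' z)) (at z)"
    using assms unfolding C1_on_def by blast
  show ?thesis
    by (rule continuous_at_imp_continuous_on) (use has_derivative_continuous[OF f'] in blast)
qed

lemma C2_on_deriv_continuous:
  fixes v :: "real \<Rightarrow> real"
  assumes "C2_on UNIV v"
  shows "continuous_on UNIV (deriv v)"
proof -
  obtain v' where v': "\<And>z. (v has_derivative blinfun_apply (v' z)) (at z)" "C1_on UNIV v'"
    using assms unfolding C2_on_def by blast
  have "deriv v = (\<lambda>z. blinfun_apply (v' z) 1)"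
  proof
    fix z
    have "blinfun_apply (v' z) = (*) (blinfun_apply (v' z) 1)"
    proof
      show "blinfun_apply (v' z) x = blinfun_apply (v' z) 1 * x" for x
        using blinfun.scaleR_right[of "v' z" x 1] by simp
    qed
    then have "(v has_real_derivative blinfun_apply (v' z) 1) (at z)"
      using v'(1)[of z] by (simp only: has_field_derivative_def)
    then show "deriv v z = blinfun_apply (v' z) 1" by (rule DERIV_imp_deriv)
  qed
  moreover have "continuous_on UNIV (\<lambda>z. blinfun_apply (v' z) 1)"
    by (rule bounded_linear.continuous_on[OF blinfun.bounded_linear_left C1_on_continuous[OF v'(2)]])
  ultimately show ?thesis by (simp only:)
qed

lemma growth_dominates_log:
  fixes a b q k :: real
  assumes "a > 0" "q > 0"
  shows "\<forall>\<^sub>F z in at_top. ln (1 + z\<^sup>2) + k \<le> a * z powr q + b"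
proof -
  have "filterlim (\<lambda>z. a * z powr q + b - (ln (1 + z\<^sup>2) + k)) at_top at_top"
    using assms by real_asymp
  then have "\<forall>\<^sub>F z in at_top. 0 \<le> a * z powr q + b - (ln (1 + z\<^sup>2) + k)"
    unfolding filterlim_at_top by blast
  then show ?thesis by (rule eventually_mono) linarith
qed

lemma vanishing_prefactor:
  fixes k :: real
  assumes "k > 0"
  shows "((\<lambda>\<epsilon>. \<epsilon> * ln (k / \<epsilon>)) \<longlongrightarrow> 0) (at_right 0)"
  using assms by real_asymp

lemma ext_ln_between:
  assumes "ennreal u \<le> z" "z \<le> ennreal w" "u > 0"
  obtains x where "ext_ln z = ereal (ln x)" "u \<le> x" "x \<le> w"
proof -
  obtain x where x: "z = ennreal x" "x \<ge> 0"
    using assms(2) by (cases z rule: ennreal_cases) (auto simp: top_unique)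
  have "u \<le> x" using assms x by simp
  moreover have "x \<le> w" using assms(2,3) x \<open>u \<le> x\<close>
    by (metis ennreal_le_iff2 dual_order.strict_trans2 not_le)
  ultimately show thesis using that[of x] assms(3) x by (simp add: ext_ln_def)
qed

context additive_noise_sde
begin

text \<open>For the upper bound the source is \<open>1\<close> up to a point that tends to infinity, for which the
  estimates are uniform, and the cutoff acts on \<open>[\<alpha>, y\<^sub>0]\<close>. For the lower bound a single test
  function with source cut off just beyond \<open>x\<^sub>0\<close> and intermediate level \<open>l = s\<close> suffices, since
  the climb starts near \<open>x\<^sub>0\<close> and peaks near \<open>s\<close>.\<close>

proposition mean_hitting_time_bounds:
  assumes F: "\<And>y. (F has_real_derivative F' y) (at y)" and F': "continuous_on UNIV F'"
    and drift: "\<And>y. \<beta> y = - F' y" and noise: "\<sigma>\<^sup>2 = 2 * \<epsilon>" and "\<epsilon> > 0"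
    and order: "\<alpha> < y\<^sub>0" "y\<^sub>0 < s" "r > 0" "s + r \<le> x\<^sub>0 - r"
    and A: "A \<ge> 0" "\<And>y z. \<alpha> \<le> y \<Longrightarrow> y \<le> x\<^sub>0 \<Longrightarrow> y \<le> z \<Longrightarrow> exp ((F y - F z) / \<epsilon>) \<le> A / (1 + z\<^sup>2)"
    and m: "\<And>y z. y \<in> {s..s + r} \<Longrightarrow> z \<in> {x\<^sub>0 - r..x\<^sub>0} \<Longrightarrow> m \<le> F y - F z"
  shows "ennreal (r\<^sup>2 * exp (m / \<epsilon>) / \<epsilon>) \<le> (\<integral>\<^sup>+ \<omega>. hitting_time X y\<^sub>0 \<omega> \<partial>M)"
    and "(\<integral>\<^sup>+ \<omega>. hitting_time X y\<^sub>0 \<omega> \<partial>M) \<le> ennreal ((x\<^sub>0 - \<alpha>) * (A * pi / \<epsilon>))"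
proof -
  define c where "c = (x\<^sub>0 - \<alpha>) * (A * pi / \<epsilon>)"
  have source_le: "source R y \<le> 1" and source_ge: "0 \<le> source R y" for R y by (simp_all add: source_def)
  have "\<exists>v p q. smooth_test v p q \<and> (\<forall>y. y\<^sub>0 < y \<longrightarrow> y < real (Suc n) \<longrightarrow> \<beta> y * p y + \<sigma>\<^sup>2 / 2 * q y = -1)
    \<and> (\<forall>y. v x\<^sub>0 - v y \<le> c)" for n
  proof -
    define R where "R = max x\<^sub>0 (real (Suc n))"
    have d: "y\<^sub>0 - \<alpha> > 0" and R: "y\<^sub>0 \<le> R" "x\<^sub>0 \<le> R + 1" "\<alpha> \<le> x\<^sub>0" using order by (auto simp: R_def)
    show ?thesis
    proof (rule test_function_exists[OF F F' \<open>\<epsilon> > 0\<close> d R(1)])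
      fix I v p q
      assume v: "smooth_test v p q"
        and I: "\<And>y. (I has_real_derivative source R y * exp (- F y / \<epsilon>)) (at y)"
        and p: "\<And>y. p y \<le> exp (F y / \<epsilon>) * (I (R + 1) - I y) / \<epsilon>"
        and p0: "\<And>y. y \<le> y\<^sub>0 - (y\<^sub>0 - \<alpha>) \<Longrightarrow> p y = 0"
        and gen: "\<And>y. y\<^sub>0 \<le> y \<Longrightarrow> - F' y * p y + \<epsilon> * q y = - source R y"
      have dv: "\<And>y. (v has_real_derivative p y) (at y)" and pn: "\<And>y. 0 \<le> p y"
        using v by (auto simp: smooth_test_def)
      have top: "v x\<^sub>0 - v \<alpha> \<le> c"
        unfolding c_def
        by (rule test_function_increment_le[OF \<open>\<epsilon> > 0\<close> R(3,2) A(1) I source_le dv p A(2)])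
      have "v x\<^sub>0 - v y \<le> c" for y
      proof -
        have "v \<alpha> \<le> v y"
        proof (cases "\<alpha> \<le> y")
          case True
          then show ?thesis by (rule nondecreasing_if_derivative_nonneg[OF _ dv pn])
        next
          case False
          then have "v y = v \<alpha>" by (intro increment_zero[OF _ dv]) (auto intro: p0)
          then show ?thesis by simp
        qed
        then show ?thesis using top by linarith
      qed
      moreover have "\<beta> y * p y + \<sigma>\<^sup>2 / 2 * q y = -1" if "y\<^sub>0 < y" "y < real (Suc n)" for y
        using gen[of y] that by (simp add: drift noise source_def R_def max_def min_def split: if_splits)
      ultimately show ?thesis using v by blast
    qed
  qed
  then obtain v p q where v: "\<forall>n. smooth_test (v n) (p n) (q n) \<and>
    (\<forall>y. y\<^sub>0 < y \<longrightarrow> y < real (Suc n) \<longrightarrow> \<beta> y * p n y + \<sigma>\<^sup>2 / 2 * q n y = -1) \<and> (\<forall>y. v n x\<^sub>0 - v n y \<le> c)"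
    by metis
  have "\<exists>Y. Y \<in> borel_measurable M \<and> (AE \<omega> in M. hitting_time X y\<^sub>0 \<omega> \<le> Y \<omega>) \<and> (\<integral>\<^sup>+ \<omega>. Y \<omega> \<partial>M) \<le> ennreal c"
  proof (rule hitting_time_upper_bound[of v p q y\<^sub>0 c])
    show "smooth_test (v n) (p n) (q n)" for n using v by blast
    show "\<beta> y * p n y + \<sigma>\<^sup>2 / 2 * q n y = -1" if "y\<^sub>0 < y" "y < real (Suc n)" for n y using v that by blast
    show "v n x\<^sub>0 - v n y \<le> c" for n y using v by blast
  qed blast
  then obtain Y where Y: "Y \<in> borel_measurable M" "AE \<omega> in M. hitting_time X y\<^sub>0 \<omega> \<le> Y \<omega>"
    "(\<integral>\<^sup>+ \<omega>. Y \<omega> \<partial>M) \<le> ennreal c" by blast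
  show "(\<integral>\<^sup>+ \<omega>. hitting_time X y\<^sub>0 \<omega> \<partial>M) \<le> ennreal ((x\<^sub>0 - \<alpha>) * (A * pi / \<epsilon>))"
    using nn_integral_mono_AE[OF Y(2)] Y(3) unfolding c_def by (rule order_trans)
  have Y_fin: "(\<integral>\<^sup>+ \<omega>. Y \<omega> \<partial>M) < \<infinity>"
    using Y(3) by (simp add: order_le_less_trans)
  have sx: "s \<le> x\<^sub>0" "s < x\<^sub>0" "x\<^sub>0 \<le> x\<^sub>0 + 1" using order by auto
  show "ennreal (r\<^sup>2 * exp (m / \<epsilon>) / \<epsilon>) \<le> (\<integral>\<^sup>+ \<omega>. hitting_time X y\<^sub>0 \<omega> \<partial>M)"
  proof (rule test_function_exists[OF F F' \<open>\<epsilon> > 0\<close> zero_less_one sx(1)])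
    fix I v p q
    assume v: "smooth_test v p q"
      and I: "\<And>y. (I has_real_derivative source x\<^sub>0 y * exp (- F y / \<epsilon>)) (at y)"
      and p: "\<And>y. s \<le> y \<Longrightarrow> p y = exp (F y / \<epsilon>) * (I (x\<^sub>0 + 1) - I y) / \<epsilon>"
      and gen: "\<And>y. s \<le> y \<Longrightarrow> - F' y * p y + \<epsilon> * q y = - source x\<^sub>0 y"
    have dv: "\<And>y. (v has_real_derivative p y) (at y)" and pn: "\<And>y. 0 \<le> p y"
      using v by (auto simp: smooth_test_def)
    have one: "source x\<^sub>0 y = 1" if "y \<le> x\<^sub>0" for y using that by (simp add: source_def)
    have "r\<^sup>2 * exp (m / \<epsilon>) / \<epsilon> \<le> v x\<^sub>0 - v s"
      by (rule test_function_increment_ge[OF \<open>\<epsilon> > 0\<close> order_refl order(3,4) sx(3) I source_ge one dv p pn m])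
    moreover have "ennreal (v x\<^sub>0 - v s) \<le> (\<integral>\<^sup>+ \<omega>. hitting_time X y\<^sub>0 \<omega> \<partial>M)"
    proof (rule hitting_time_lower_bound[OF v order(2) sx(2) _ Y(1,2) Y_fin])
      show "- 1 \<le> \<beta> y * p y + \<sigma>\<^sup>2 / 2 * q y" if "s < y" for y
        using gen[of y] source_le[of x\<^sub>0 y] that by (simp add: drift noise)
    qed
    ultimately show ?thesis by (meson ennreal_leI order_trans)
  qed
qed

end

text \<open>The prefactors of the two bounds are of the form \<open>k / \<epsilon>\<close> with \<open>k\<close> independent of \<open>\<epsilon>\<close>, and
  \<open>\<epsilon> ln (k / \<epsilon>)\<close> vanishes in the limit. The exponents differ from the barrier height by at most
  \<open>4 \<eta>\<close>: two from the approximation of \<open>F\<^sub>\<epsilon>\<close> by \<open>F0\<close>, and two from the continuity of \<open>F0\<close>.\<close>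

proposition kramers_law:
  fixes F :: "real \<Rightarrow> real \<Rightarrow> real" and F' :: "real \<Rightarrow> real \<Rightarrow> real" and F0 :: "real \<Rightarrow> real"
  assumes BM: "brownian_motion M Fil W"
    and F_deriv: "\<And>\<epsilon> x. \<epsilon> > 0 \<Longrightarrow> (F \<epsilon> has_real_derivative F' \<epsilon> x) (at x)"
    and F'_cont: "\<And>\<epsilon>. \<epsilon> > 0 \<Longrightarrow> continuous_on UNIV (F' \<epsilon>)"
    and F_limit: "\<And>S. compact S \<Longrightarrow> uniform_limit S F F0 (at_right 0)"
    and dw: "double_well F0 xm xs xp"
    and growth_pos: "a > 0" "q > 0"
    and F_growth: "\<And>\<epsilon> x. \<epsilon> > 0 \<Longrightarrow> x > K \<Longrightarrow> F \<epsilon> x \<ge> a * x powr q + b"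
    and X: "\<And>\<epsilon>. \<epsilon> > 0 \<Longrightarrow> sde_solution M Fil W (\<lambda>t \<omega> y. - F' \<epsilon> y) (sqrt (2 * \<epsilon>)) xp (X \<epsilon>)"
  shows "((\<lambda>\<epsilon>. ereal \<epsilon> * ext_ln (\<integral>\<^sup>+ \<omega>. hitting_time (X \<epsilon>) xm \<omega> \<partial>M))
    \<longlongrightarrow> ereal (F0 xs - F0 xp)) (at_right 0)"
proof -
  define D where "D = F0 xs - F0 xp"
  have ord: "xm < xs" "xs < xp" using dw by (auto simp: double_well_def)
  have pos: "\<forall>\<^sub>F \<epsilon> in at_right (0::real). 0 < \<epsilon>" by (rule eventually_at_right_less)
  have F0_cont: "continuous_on UNIV F0"
  proof -
    have "continuous_on {x - 1..x + 1} F0" for x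
    proof (rule uniform_limit_theorem[OF _ F_limit])
      show "\<forall>\<^sub>F \<epsilon> in at_right 0. continuous_on {x - 1..x + 1} (F \<epsilon>)"
        using pos by (rule eventually_mono) (rule continuous_on_if_derivative[OF F_deriv])
    qed auto
    then have "isCont F0 x" for x
      by (rule continuous_on_interior[of "{x - 1..x + 1}"]) simp
    then show ?thesis by (simp add: continuous_on_eq_continuous_at)
  qed
  have F0_growth: "a * x powr q + b \<le> F0 x" if "x > K" for x
  proof (rule tendsto_lowerbound)
    show "((\<lambda>\<epsilon>. F \<epsilon> x) \<longlongrightarrow> F0 x) (at_right 0)"
      by (rule tendsto_uniform_limitI[OF F_limit[of "{x}"]]) auto
    show "\<forall>\<^sub>F \<epsilon> in at_right 0. a * x powr q + b \<le> F \<epsilon> x"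
      using pos by (rule eventually_mono) (use F_growth that in blast)
  qed simp
  have F0_lim: "filterlim F0 at_top at_top"
  proof (rule filterlim_at_top_mono)
    show "filterlim (\<lambda>x. a * x powr q + b) at_top at_top" using growth_pos by real_asymp
    show "\<forall>\<^sub>F x in at_top. a * x powr q + b \<le> F0 x"
      using eventually_gt_at_top[of K] by (rule eventually_mono) (rule F0_growth)
  qed
  have squeeze: "\<forall>\<^sub>F \<epsilon> in at_right 0. \<exists>L. ext_ln (\<integral>\<^sup>+ \<omega>. hitting_time (X \<epsilon>) xm \<omega> \<partial>M) = ereal L \<and> \<bar>\<epsilon> * L - D\<bar> < e"
    if e: "e > 0" for e
  proof -
    define \<eta> where "\<eta> = e / 8"
    have \<eta>: "\<eta> > 0" using e by (simp add: \<eta>_def)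
    obtain \<delta> where \<delta>: "\<delta> > 0" and top: "\<And>y. xm - \<delta> \<le> y \<Longrightarrow> y \<le> xp \<Longrightarrow> F0 y \<le> F0 xs + \<eta>"
      and barrier: "\<And>y z. xm - \<delta> \<le> y \<Longrightarrow> y \<le> xp \<Longrightarrow> y \<le> z \<Longrightarrow> F0 y - F0 z \<le> F0 xs - F0 xp + 2 * \<eta>"
      using double_well_barrier[OF F0_cont dw F0_lim \<eta>] by blast
    define \<alpha> where "\<alpha> = xm - \<delta>"
    have "\<forall>\<^sub>F z in at_top. ln (1 + z\<^sup>2) + F0 xp \<le> a * z powr q + b \<and> max K xp < z"
      by (intro eventually_conj growth_dominates_log growth_pos eventually_gt_at_top)
    then obtain R where R: "\<And>z. R \<le> z \<Longrightarrow> ln (1 + z\<^sup>2) + F0 xp \<le> a * z powr q + b \<and> max K xp < z"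
      by (auto simp: eventually_at_top_linorder)
    have Rxp: "xp < R" using R[of R] by simp
    \<comment> \<open>makes \<open>c / (1 + z\<^sup>2) \<ge> 1\<close> for all \<open>z\<close> between \<open>\<alpha>\<close> and \<open>R\<close>\<close>
    define c where "c = 1 + (\<bar>\<alpha>\<bar> + \<bar>R\<bar>)\<^sup>2"
    have c1: "c \<ge> 1" by (simp add: c_def)
    have "isCont F0 xs" "isCont F0 xp" using F0_cont by (simp_all add: continuous_on_eq_continuous_at)
    then obtain d1 d2 where d: "d1 > 0" "d2 > 0" "\<And>y. dist y xs < d1 \<Longrightarrow> dist (F0 y) (F0 xs) < \<eta>"
      "\<And>y. dist y xp < d2 \<Longrightarrow> dist (F0 y) (F0 xp) < \<eta>"
      using \<eta> unfolding continuous_at_eps_delta by metis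
    define r where "r = min (min d1 d2) (xp - xs) / 2"
    have r: "r > 0" "r < d1" "r < d2" "xs + r \<le> xp - r" using d(1,2) ord by (auto simp: r_def min_def field_simps)
    define k where "k = (xp - \<alpha>) * (c * pi)"
    have k: "k > 0" unfolding k_def using c1 ord \<delta> by (intro mult_pos_pos) (auto simp: \<alpha>_def)
    have "\<forall>\<^sub>F \<epsilon> in at_right 0. \<forall>x\<in>{\<alpha>..R}. dist (F \<epsilon> x) (F0 x) < \<eta>"
      using F_limit[of "{\<alpha>..R}"] \<eta> by (simp add: uniform_limit_iff)
    moreover have "\<forall>\<^sub>F \<epsilon> in at_right (0::real). \<epsilon> < 1" by (rule eventually_at_right_real[THEN eventually_mono]) auto
    moreover have "\<forall>\<^sub>F \<epsilon> in at_right 0. \<epsilon> * ln (k / \<epsilon>) < \<eta>" 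
      by (rule order_tendstoD(2)[OF vanishing_prefactor[OF k] \<eta>])
    moreover have "\<forall>\<^sub>F \<epsilon> in at_right 0. - \<eta> < \<epsilon> * ln (r\<^sup>2 / \<epsilon>)"
      by (rule order_tendstoD(1)[OF vanishing_prefactor]) (use r \<eta> in auto)
    ultimately show ?thesis using pos
    proof eventually_elim
      case (elim \<epsilon>)
      note \<epsilon> = \<open>0 < \<epsilon>\<close>
      have near: "\<bar>F \<epsilon> x - F0 x\<bar> < \<eta>" if "\<alpha> \<le> x" "x \<le> R" for x
        using elim(1) that by (auto simp: dist_real_def)
      interpret additive_noise_sde M Fil W "X \<epsilon>" "\<lambda>y. - F' \<epsilon> y" "sqrt (2 * \<epsilon>)" xp
        by (intro additive_noise_sde.intro additive_noise_sde_axioms.intro BM X \<epsilon> continuous_on_minus F'_cont)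
      have upper: "exp ((F \<epsilon> y - F \<epsilon> z) / \<epsilon>) \<le> c * exp ((D + 4 * \<eta>) / \<epsilon>) / (1 + z\<^sup>2)"
        if y: "\<alpha> \<le> y" "y \<le> xp" "y \<le> z" for y z
      proof (cases "z \<le> R")
        case True
        have "F \<epsilon> y - F \<epsilon> z \<le> D + 4 * \<eta>"
          using near[of y] near[of z] barrier[of y z] y True Rxp by (simp add: D_def \<alpha>_def)
        then have "exp ((F \<epsilon> y - F \<epsilon> z) / \<epsilon>) \<le> 1 * exp ((D + 4 * \<eta>) / \<epsilon>)"
          using \<epsilon> by (simp add: divide_right_mono)
        also have "\<dots> \<le> c / (1 + z\<^sup>2) * exp ((D + 4 * \<eta>) / \<epsilon>)"
        proof (rule mult_right_mono)
          have "\<bar>z\<bar> \<le> \<bar>\<alpha>\<bar> + \<bar>R\<bar>" using y True by linarith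
          then have "z\<^sup>2 \<le> (\<bar>\<alpha>\<bar> + \<bar>R\<bar>)\<^sup>2" by (simp add: abs_le_square_iff[symmetric])
          then show "1 \<le> c / (1 + z\<^sup>2)" by (simp add: c_def add_pos_nonneg)
        qed simp
        finally show ?thesis by simp
      next
        case False
        then have z: "R \<le> z" "K < z" using R[of z] by auto
        have pz: "0 < 1 + z\<^sup>2" by (simp add: add_pos_nonneg)
        have "F \<epsilon> y \<le> F0 xs + 2 * \<eta>" using near[of y] top[of y] y Rxp by (simp add: \<alpha>_def)
        moreover have "ln (1 + z\<^sup>2) + F0 xp \<le> F \<epsilon> z" using R[OF z(1)] F_growth[OF \<epsilon> z(2)] by linarith
        ultimately have "F \<epsilon> y - F \<epsilon> z \<le> (D + 4 * \<eta>) - ln (1 + z\<^sup>2)" using \<eta> by (simp add: D_def)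
        then have "(F \<epsilon> y - F \<epsilon> z) / \<epsilon> \<le> (D + 4 * \<eta>) / \<epsilon> - ln (1 + z\<^sup>2) / \<epsilon>"
          using \<epsilon> by (metis diff_divide_distrib divide_right_mono less_imp_le)
        \<comment> \<open>a factor \<open>1 / \<epsilon>\<close> on the logarithm only helps, so that the dependence of the majorant on \<open>z\<close> is free of \<open>\<epsilon>\<close>\<close>
        moreover have "ln (1 + z\<^sup>2) \<le> ln (1 + z\<^sup>2) / \<epsilon>"
          using \<epsilon> elim(2) ln_ge_zero[of "1 + z\<^sup>2"] by (simp add: field_simps mult_left_le_one_le)
        ultimately have "(F \<epsilon> y - F \<epsilon> z) / \<epsilon> \<le> (D + 4 * \<eta>) / \<epsilon> - ln (1 + z\<^sup>2)" by linarith
        then have "exp ((F \<epsilon> y - F \<epsilon> z) / \<epsilon>) \<le> exp ((D + 4 * \<eta>) / \<epsilon> - ln (1 + z\<^sup>2))" by simp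
        also have "\<dots> = 1 * exp ((D + 4 * \<eta>) / \<epsilon>) / (1 + z\<^sup>2)" using pz by (simp add: exp_diff)
        also have "\<dots> \<le> c * exp ((D + 4 * \<eta>) / \<epsilon>) / (1 + z\<^sup>2)"
          using c1 pz by (intro divide_right_mono mult_right_mono) auto
        finally show ?thesis .
      qed
      have lower: "D - 4 * \<eta> \<le> F \<epsilon> y - F \<epsilon> z" if "y \<in> {xs..xs + r}" "z \<in> {xp - r..xp}" for y z
      proof -
        have "\<bar>F0 y - F0 xs\<bar> < \<eta>" "\<bar>F0 z - F0 xp\<bar> < \<eta>"
          using d(3)[of y] d(4)[of z] that r by (auto simp: dist_real_def)
        moreover have "\<bar>F \<epsilon> y - F0 y\<bar> < \<eta>" "\<bar>F \<epsilon> z - F0 z\<bar> < \<eta>"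
          using near[of y] near[of z] that r ord Rxp \<delta> by (auto simp: \<alpha>_def)
        ultimately show ?thesis by (simp add: D_def)
      qed
      have sq: "(sqrt (2 * \<epsilon>))\<^sup>2 = 2 * \<epsilon>" using \<epsilon> by simp
      have c0: "0 \<le> c * exp ((D + 4 * \<eta>) / \<epsilon>)" using c1 by simp
      have \<alpha>xm: "\<alpha> < xm" using \<delta> by (simp add: \<alpha>_def)
      note bounds = mean_hitting_time_bounds[OF F_deriv[OF \<epsilon>] F'_cont[OF \<epsilon>] refl sq \<epsilon> \<alpha>xm ord(1) r(1,4) c0 upper lower]
      define u where "u = r\<^sup>2 * exp ((D - 4 * \<eta>) / \<epsilon>) / \<epsilon>"
      define w where "w = (xp - \<alpha>) * (c * exp ((D + 4 * \<eta>) / \<epsilon>) * pi / \<epsilon>)"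
      have u: "u > 0" using r(1) \<epsilon> by (simp add: u_def)
      have ln_u: "\<epsilon> * ln u = \<epsilon> * ln (r\<^sup>2 / \<epsilon>) + (D - 4 * \<eta>)"
      proof -
        have "u = r\<^sup>2 / \<epsilon> * exp ((D - 4 * \<eta>) / \<epsilon>)" by (simp add: u_def)
        then have "ln u = ln (r\<^sup>2 / \<epsilon>) + (D - 4 * \<eta>) / \<epsilon>" using r(1) \<epsilon> by (simp only: ln_mult_pos ln_exp exp_gt_zero divide_pos_pos zero_less_power)
        then show ?thesis using \<epsilon> by (simp only: distrib_left) simp
      qed
      have ln_w: "\<epsilon> * ln w = \<epsilon> * ln (k / \<epsilon>) + (D + 4 * \<eta>)"
      proof -
        have "w = k / \<epsilon> * exp ((D + 4 * \<eta>) / \<epsilon>)" by (simp add: w_def k_def)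
        then have "ln w = ln (k / \<epsilon>) + (D + 4 * \<eta>) / \<epsilon>" using k \<epsilon> by (simp only: ln_mult_pos ln_exp exp_gt_zero divide_pos_pos)
        then show ?thesis using \<epsilon> by (simp only: distrib_left) simp
      qed
      show ?case
      proof (rule ext_ln_between[OF bounds(1)[folded u_def] bounds(2)[folded w_def] u])
        fix x assume x: "ext_ln (\<integral>\<^sup>+ \<omega>. hitting_time (X \<epsilon>) xm \<omega> \<partial>M) = ereal (ln x)" "u \<le> x" "x \<le> w"
        have "\<epsilon> * ln u \<le> \<epsilon> * ln x" "\<epsilon> * ln x \<le> \<epsilon> * ln w"
          using x u \<epsilon> by (auto intro!: mult_left_mono)
        then have "\<bar>\<epsilon> * ln x - D\<bar> < e" using elim(3,4) \<eta> unfolding ln_u ln_w \<eta>_def by linarith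
        then show ?case using x(1) by blast
      qed
    qed
  qed
  define L where "L \<epsilon> = real_of_ereal (ext_ln (\<integral>\<^sup>+ \<omega>. hitting_time (X \<epsilon>) xm \<omega> \<partial>M))" for \<epsilon>
  have "((\<lambda>\<epsilon>. \<epsilon> * L \<epsilon>) \<longlongrightarrow> D) (at_right 0)"
  proof (rule tendstoI)
    fix e :: real assume "e > 0"
    from squeeze[OF this] show "\<forall>\<^sub>F \<epsilon> in at_right 0. dist (\<epsilon> * L \<epsilon>) D < e"
      by (rule eventually_mono) (auto simp: L_def dist_real_def)
  qed
  then have "((\<lambda>\<epsilon>. ereal (\<epsilon> * L \<epsilon>)) \<longlongrightarrow> ereal D) (at_right 0)" by (rule tendsto_ereal)
  moreover have "\<forall>\<^sub>F \<epsilon> in at_right 0. ereal (\<epsilon> * L \<epsilon>) = ereal \<epsilon> * ext_ln (\<integral>\<^sup>+ \<omega>. hitting_time (X \<epsilon>) xm \<omega> \<partial>M)"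
    using squeeze[OF zero_less_one] by (rule eventually_mono) (auto simp: L_def)
  ultimately show ?thesis unfolding D_def by (rule Lim_transform_eventually)
qed

text \<open>The value function is twice continuously differentiable and \<open>f\<close> and \<open>g\<close> are continuous, so the
  closed-loop drift is continuous and \<open>F\<^sub>\<epsilon>\<close> is a potential of the kind that \<open>kramers_law\<close> is about.\<close>

theorem theorem4:
  fixes M :: "'w measure" and Fil :: "real \<Rightarrow> 'w measure" and W :: "real \<Rightarrow> 'w \<Rightarrow> real"
    and f G H g :: "real \<Rightarrow> real \<Rightarrow> real"
    and V F :: "real \<Rightarrow> real \<Rightarrow> real" and V0 F0 :: "real \<Rightarrow> real"
    and X :: "real \<Rightarrow> real \<Rightarrow> 'w \<Rightarrow> real"
    and \<rho> C a q K b xm xs xp :: real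
  assumes BM: "brownian_motion M Fil W"
    and rho: "\<rho> > 0"
    and f_C1: "C1_on (UNIV \<times> {0<..}) (\<lambda>(x, u). f x u)"
    and f_x: "\<And>x u. u > 0 \<Longrightarrow> \<bar>deriv (\<lambda>y. f y u) x\<bar> \<le> C"
    and f_growth: "\<And>x u. u > 0 \<Longrightarrow> \<bar>f x u\<bar> \<le> C * (1 + \<bar>x\<bar> + \<bar>u\<bar>)"
    and G_cont: "continuous_on (UNIV \<times> {0<..}) (\<lambda>(x, u). G x u)"
    and G_C1: "\<And>x. C1_on {0<..} (G x)"
    and V: "\<And>\<epsilon> x. \<epsilon> > 0 \<Longrightarrow> value_function M Fil W f G \<rho> \<epsilon> x = ereal (V \<epsilon> x)"
    and H: "\<And>x p. hamiltonian f G x p = ereal (H x p)"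
    and HJB_C2: "\<And>\<epsilon>. \<epsilon> > 0 \<Longrightarrow> C2_on UNIV (V \<epsilon>)"
    and HJB: "\<And>\<epsilon> x. \<epsilon> > 0 \<Longrightarrow>
      - \<epsilon> * deriv (deriv (V \<epsilon>)) x - H x (deriv (V \<epsilon>) x) + \<rho> * V \<epsilon> x = 0"
    and V_bounded: "\<exists>\<epsilon>\<^sub>0>0. \<forall>S. compact S \<longrightarrow>
      (\<exists>B. \<forall>\<epsilon>. 0 < \<epsilon> \<and> \<epsilon> < \<epsilon>\<^sub>0 \<longrightarrow> (\<forall>x\<in>S. \<bar>V \<epsilon> x\<bar> \<le> B \<and> \<bar>deriv (V \<epsilon>) x\<bar> \<le> B))"
    and H_C2: "C2_on UNIV (\<lambda>(x, p). H x p)"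
    and H_pp: "\<And>x p. deriv (deriv (H x)) p > 0"
    and g_pos: "\<And>x p. g x p > 0"
    and g_cont: "continuous_on UNIV (\<lambda>(x, p). g x p)"
    and optimal: "\<And>\<epsilon>. \<epsilon> > 0 \<Longrightarrow>
      optimal_markov_policy M Fil W f G \<rho> \<epsilon> (\<lambda>x. g x (deriv (V \<epsilon>) x))"
    and first_order: "\<And>\<epsilon> x. \<epsilon> > 0 \<Longrightarrow>
      deriv (f x) (g x (deriv (V \<epsilon>) x)) * deriv (V \<epsilon>) x + deriv (G x) (g x (deriv (V \<epsilon>) x)) = 0"
    and V_limit: "\<And>S. compact S \<Longrightarrow> uniform_limit S V V0 (at_right 0)"
    and V0_viscosity: "viscosity_solution (\<lambda>x r p. - H x p + \<rho> * r) V0"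
    and V0_diff: "AE x in lborel. V0 differentiable (at x)"
    and F_deriv: "\<And>\<epsilon> x. \<epsilon> > 0 \<Longrightarrow>
      (F \<epsilon> has_real_derivative - f x (g x (deriv (V \<epsilon>) x))) (at x)"
    and F_0: "\<And>\<epsilon>. \<epsilon> > 0 \<Longrightarrow> F \<epsilon> 0 = 0"
    and F_limit: "\<And>S. compact S \<Longrightarrow> uniform_limit S F F0 (at_right 0)"
    and F0_double_well: "double_well F0 xm xs xp"
    and F0_C1: "\<And>z. z \<in> {xm, xs, xp} \<Longrightarrow> \<exists>\<delta>>0. C1_on (ball z \<delta>) F0"
    and growth_pos: "a > 0" "q > 0" "K > 0"
    and F_growth: "\<And>\<epsilon> x. \<epsilon> > 0 \<Longrightarrow> x > K \<Longrightarrow> F \<epsilon> x \<ge> a * x powr q + b"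
    and X: "\<And>\<epsilon>. \<epsilon> > 0 \<Longrightarrow>
      sde_solution M Fil W (\<lambda>t \<omega> y. - deriv (F \<epsilon>) y) (sqrt (2 * \<epsilon>)) xp (X \<epsilon>)"
  shows "((\<lambda>\<epsilon>. ereal \<epsilon> * ext_ln (\<integral>\<^sup>+ \<omega>. hitting_time (X \<epsilon>) xm \<omega> \<partial>M))
    \<longlongrightarrow> ereal (F0 xs - F0 xp)) (at_right 0)"
proof -
  define F' where "F' \<epsilon> x = - f x (g x (deriv (V \<epsilon>) x))" for \<epsilon> x
  have F': "continuous_on UNIV (F' \<epsilon>)" if "\<epsilon> > 0" for \<epsilon>
  proof -
    have dV: "continuous_on UNIV (deriv (V \<epsilon>))" by (rule C2_on_deriv_continuous[OF HJB_C2[OF that]])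
    have "continuous_on UNIV (\<lambda>x. case (x, deriv (V \<epsilon>) x) of (x, p) \<Rightarrow> g x p)"
      by (rule continuous_on_compose2[OF g_cont]) (auto intro!: continuous_on_Pair dV continuous_on_id)
    then have policy: "continuous_on UNIV (\<lambda>x. g x (deriv (V \<epsilon>) x))" by simp
    have "continuous_on UNIV (\<lambda>x. case (x, g x (deriv (V \<epsilon>) x)) of (x, u) \<Rightarrow> f x u)"
      by (rule continuous_on_compose2[OF C1_on_continuous[OF f_C1]])
        (auto intro!: continuous_on_Pair policy continuous_on_id g_pos)
    then show ?thesis unfolding F'_def by (auto intro: continuous_on_minus)
  qed
  have deriv_F: "deriv (F \<epsilon>) = F' \<epsilon>" if "\<epsilon> > 0" for \<epsilon>
    using DERIV_imp_deriv[OF F_deriv[OF that]] by (simp add: fun_eq_iff F'_def)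
  show ?thesis
  proof (rule kramers_law[OF BM _ F' F_limit F0_double_well growth_pos(1,2) F_growth])
    show "(F \<epsilon> has_real_derivative F' \<epsilon> x) (at x)" if "\<epsilon> > 0" for \<epsilon> x
      unfolding F'_def by (rule F_deriv[OF that])
    show "sde_solution M Fil W (\<lambda>t \<omega> y. - F' \<epsilon> y) (sqrt (2 * \<epsilon>)) xp (X \<epsilon>)" if "\<epsilon> > 0" for \<epsilon>
      using X[OF that] unfolding deriv_F[OF that] .
  qed
qed

end
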